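(* Let $(T,\Sigma,\mu)$ be a non-atomic, $\sigma$-finite measure space, $\Phi$ a Musielak--Orlicz function on $T$, and $u\in L_0^\Phi\setminus\{0\}$ such that $K(u)=\emptyset$. Then a functional $f=f_v+f_{\mathrm s}\in(L_0^\Phi)^*$ (with order continuous component $f_v$, $v\in L^{\Phi^*}$, and singular component $f_{\mathrm s}$) is a support functional at $u$ if and only if (i) $I_{\Phi^*}(v)+\|f_{\mathrm s}\|\le1$, and (ii) $v\chi_{\operatorname{supp}u}=\operatorname{sgn}u\cdot b_{\Phi^*}\chi_{\operatorname{supp}u}$.
   Context: A function $\Phi\colon T\times[0,\infty]\to[0,\infty]$ is a Musielak--Orlicz function if, for $\mu$-a.e. $t\in T$: (i) $\Phi(t,\cdot)$ is convex and lower semi-continuous; (ii) $\Phi(t,0)=\lim_{u\downarrow0}\Phi(t,u)=0$ and $\Phi(t,\infty)=\infty$; and (iii) $\Phi(\cdot,u)$ is measurable for all $u\ge0$. The complementary function is $\Phi^*(t,v)=\sup_{u>0}(uv-\Phi(t,u))$, $v\ge0$; it is again a Musielak--Orlicz function. $b_{\Phi^*}(t)=\sup\{v\ge0:\Phi^*(t,v)<\infty\}$. $\operatorname{supp}u=\{t\in T:|u(t)|>0\}$ and $\chi_A$ is the indicator function of $A$. $L^0$ is the space of real-valued measurable functions on $T$ (equality $\mu$-a.e.), $I_\Phi(u)=\int_T\Phi(t,|u(t)|)\,d\mu$, $L^\Phi=\{u\in L^0: I_\Phi(\lambda u)<\infty\text{ for some }\lambda>0\}$, $\tilde L^\Phi=\{u\in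 L^0:I_\Phi(u)<\infty\}$. The Orlicz norm is $\|u\|_{\Phi,0}=\sup\{|\int_T uv\,d\mu|: v\in\tilde L^{\Phi^*},\ I_{\Phi^*}(v)\le1\}$, and it coincides on $L^\Phi$ with the Amemiya norm $\inf_{k>0}\frac1k(1+I_\Phi(ku))$. $L_0^\Phi$ is the Banach space $L^\Phi$ with the norm $\|\cdot\|_{\Phi,0}$. $K(u)$ is the set of all $k>0$ at which the infimum $\inf_{k>0}\frac1k(1+I_\Phi(ku))$ is attained. For $f\in(L_0^\Phi)^*$, $\|f\|=\sup_{u\neq0}|f(u)|/\|u\|_{\Phi,0}$. For $v\in L^{\Phi^*}$, $f_v(u)=\int_T uv\,d\mu$. Every $f\in(L^\Phi)^*$ decomposes uniquely as $f=f_{\mathrm c}+f_{\mathrm s}$, where $f_{\mathrm c}=f_v$ for some $v\in L^{\Phi^*}$ (order continuous component) and $f_{\mathrm s}$ is purely singular, i.e. has zero order continuous component. For a positive functional $f$ and $0\le u\in L^\Phi$, $f_{\mathrm c}(u)=\inf\{\sup_n f(u_n):0\le u_n\uparrow u\}$ and $f_{\mathrm s}(u)=\sup\{\inf_n f(u_n):u\ge u_n\downarrow0\}$; for general $f$ one uses the positive and negative parts. A support functional at $u\ne0$ is an $f\in(L_0^\Phi)^*$ with $\|f\|=1$ and $f(u)=\|u\|_{\Phi,0}$. *)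

theory Defs
  imports "HOL-Analysis.Analysis"
begin

definition non_atomic :: "'a measure \<Rightarrow> bool" where
  "non_atomic M \<longleftrightarrow>
     (\<forall>A\<in>sets M. 0 < emeasure M A \<longrightarrow>
        (\<exists>B\<in>sets M. B \<subseteq> A \<and> 0 < emeasure M B \<and> emeasure M B < emeasure M A))"

definition convex_ennreal :: "(ennreal \<Rightarrow> ennreal) \<Rightarrow> bool" where
  "convex_ennreal \<phi> \<longleftrightarrow>
     (\<forall>x y. \<forall>l\<in>{0..1::real}.
        \<phi> (ennreal l * x + ennreal (1 - l) * y)
          \<le> ennreal l * \<phi> x + ennreal (1 - l) * \<phi> y)"

definition lower_semicontinuous_ennreal :: "(ennreal \<Rightarrow> ennreal) \<Rightarrow> bool" where
  "lower_semicontinuous_ennreal \<phi> \<longleftrightarrow> (\<forall>x. \<phi> x \<le> Liminf (at x) \<phi>)"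

text \<open>The type \<^typ>\<open>ennreal\<close> is the interval from 0 to infinity, both endpoints included.
  Lower semicontinuity is required at infinity too; together with the value at infinity it
  forces \<open>\<Phi> t u\<close> to tend to infinity with \<open>u\<close>. Measurability of the sections is only asked
  for finite \<open>u\<close>; at infinity the section is almost everywhere constant anyway.\<close>

definition musielak_orlicz :: "'a measure \<Rightarrow> ('a \<Rightarrow> ennreal \<Rightarrow> ennreal) \<Rightarrow> bool" where
  "musielak_orlicz M \<Phi> \<longleftrightarrow>
     (AE t in M. convex_ennreal (\<Phi> t) \<and> lower_semicontinuous_ennreal (\<Phi> t) \<and>
        \<Phi> t 0 = 0 \<and> (\<Phi> t \<longlongrightarrow> 0) (at_right 0) \<and> \<Phi> t \<infinity> = \<infinity>) \<and>
     (\<forall>u\<ge>0. (\<lambda>t. \<Phi> t (ennreal u)) \<in> borel_measurable M)"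

text \<open>Subtraction on \<^typ>\<open>ennreal\<close> truncates at 0. This does not change the supremum: since
  \<open>\<Phi> t u\<close> tends to 0 as \<open>u\<close> decreases to 0, the supremum of the untruncated differences is
  nonnegative for almost every \<open>t\<close>.\<close>

definition complementary :: "('a \<Rightarrow> ennreal \<Rightarrow> ennreal) \<Rightarrow> 'a \<Rightarrow> ennreal \<Rightarrow> ennreal" where
  "complementary \<Phi> t v = (SUP u\<in>{0<..<\<infinity>}. u * v - \<Phi> t u)"

definition finiteness_bound :: "('a \<Rightarrow> ennreal \<Rightarrow> ennreal) \<Rightarrow> 'a \<Rightarrow> ennreal" where
  "finiteness_bound \<Psi> t = Sup {v. \<Psi> t v < \<infinity>}"

definition modular ::
  "'a measure \<Rightarrow> ('a \<Rightarrow> ennreal \<Rightarrow> ennreal) \<Rightarrow> ('a \<Rightarrow> real) \<Rightarrow> ennreal" where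
  "modular M \<Phi> u = (\<integral>\<^sup>+ t. \<Phi> t (ennreal \<bar>u t\<bar>) \<partial>M)"

text \<open>Elements of the function spaces are represented by measurable functions, without passing
  to the quotient modulo equality almost everywhere; order relations, limits and vanishing of
  such elements are therefore stated almost everywhere.\<close>

definition orlicz_space ::
  "'a measure \<Rightarrow> ('a \<Rightarrow> ennreal \<Rightarrow> ennreal) \<Rightarrow> ('a \<Rightarrow> real) set" where
  "orlicz_space M \<Phi> =
     {u \<in> borel_measurable M. \<exists>c>0. modular M \<Phi> (\<lambda>t. c * u t) < \<infinity>}"

definition orlicz_class ::
  "'a measure \<Rightarrow> ('a \<Rightarrow> ennreal \<Rightarrow> ennreal) \<Rightarrow> ('a \<Rightarrow> real) set" where
  "orlicz_class M \<Phi> = {u \<in> borel_measurable M. modular M \<Phi> u < \<infinity>}"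

text \<open>On \<open>orlicz_space M \<Phi>\<close> the products are integrable and the set of integrals is bounded (by
  Young's inequality), so that the real supremum is the true one.\<close>

definition orlicz_norm ::
  "'a measure \<Rightarrow> ('a \<Rightarrow> ennreal \<Rightarrow> ennreal) \<Rightarrow> ('a \<Rightarrow> real) \<Rightarrow> real" where
  "orlicz_norm M \<Phi> u =
     (SUP v\<in>{v \<in> orlicz_class M (complementary \<Phi>). modular M (complementary \<Phi>) v \<le> 1}.
        \<bar>\<integral>t. u t * v t \<partial>M\<bar>)"

definition amemiya ::
  "'a measure \<Rightarrow> ('a \<Rightarrow> ennreal \<Rightarrow> ennreal) \<Rightarrow> ('a \<Rightarrow> real) \<Rightarrow> real \<Rightarrow> ennreal" where
  "amemiya M \<Phi> u k = (1 + modular M \<Phi> (\<lambda>t. k * u t)) / ennreal k"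

definition amemiya_minimizers ::
  "'a measure \<Rightarrow> ('a \<Rightarrow> ennreal \<Rightarrow> ennreal) \<Rightarrow> ('a \<Rightarrow> real) \<Rightarrow> real set" where
  "amemiya_minimizers M \<Phi> u =
     {k. 0 < k \<and> amemiya M \<Phi> u k = (INF l\<in>{0<..}. amemiya M \<Phi> u l)}"

text \<open>Only the values of a functional on \<open>orlicz_space M \<Phi>\<close> matter. Invariance under equality
  almost everywhere follows from linearity and boundedness, because the norm of a function
  vanishing almost everywhere is 0.\<close>

definition orlicz_dual ::
  "'a measure \<Rightarrow> ('a \<Rightarrow> ennreal \<Rightarrow> ennreal) \<Rightarrow> (('a \<Rightarrow> real) \<Rightarrow> real) set" where
  "orlicz_dual M \<Phi> =
     {f. (\<forall>u\<in>orlicz_space M \<Phi>. \<forall>w\<in>orlicz_space M \<Phi>. f (\<lambda>t. u t + w t) = f u + f w) \<and>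
         (\<forall>u\<in>orlicz_space M \<Phi>. \<forall>c. f (\<lambda>t. c * u t) = c * f u) \<and>
         (\<exists>C. \<forall>u\<in>orlicz_space M \<Phi>. \<bar>f u\<bar> \<le> C * orlicz_norm M \<Phi> u)}"

definition dual_norm ::
  "'a measure \<Rightarrow> ('a \<Rightarrow> ennreal \<Rightarrow> ennreal) \<Rightarrow> (('a \<Rightarrow> real) \<Rightarrow> real) \<Rightarrow> real" where
  "dual_norm M \<Phi> f =
     (SUP u\<in>{u \<in> orlicz_space M \<Phi>. \<not> (AE t in M. u t = 0)}. \<bar>f u\<bar> / orlicz_norm M \<Phi> u)"

definition integral_functional ::
  "'a measure \<Rightarrow> ('a \<Rightarrow> real) \<Rightarrow> ('a \<Rightarrow> real) \<Rightarrow> real" where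
  "integral_functional M v u = (\<integral>t. u t * v t \<partial>M)"

text \<open>The positive part of a functional in the dual Banach lattice, evaluated at \<open>u \<ge> 0\<close>
  (Riesz--Kantorovich formula). The negative part of \<open>f\<close> is the positive part of \<open>- f\<close>.\<close>

definition functional_pos_part ::
  "'a measure \<Rightarrow> ('a \<Rightarrow> ennreal \<Rightarrow> ennreal) \<Rightarrow> (('a \<Rightarrow> real) \<Rightarrow> real) \<Rightarrow> ('a \<Rightarrow> real) \<Rightarrow> real" where
  "functional_pos_part M \<Phi> f u =
     (SUP w\<in>{w \<in> orlicz_space M \<Phi>. AE t in M. 0 \<le> w t \<and> w t \<le> u t}. f w)"

text \<open>For a positive functional \<open>f\<close> and \<open>u \<ge> 0\<close>.\<close>

definition oc_part_cone ::
  "'a measure \<Rightarrow> ('a \<Rightarrow> ennreal \<Rightarrow> ennreal) \<Rightarrow> (('a \<Rightarrow> real) \<Rightarrow> real) \<Rightarrow> ('a \<Rightarrow> real) \<Rightarrow> real" where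
  "oc_part_cone M \<Phi> f u =
     (INF x\<in>{x :: nat \<Rightarrow> 'a \<Rightarrow> real. (\<forall>n. x n \<in> orlicz_space M \<Phi>) \<and>
               (AE t in M. (\<forall>n. 0 \<le> x n t) \<and> incseq (\<lambda>n. x n t) \<and> (\<lambda>n. x n t) \<longlonglongrightarrow> u t)}.
        SUP n. f (x n))"

definition oc_part_pos ::
  "'a measure \<Rightarrow> ('a \<Rightarrow> ennreal \<Rightarrow> ennreal) \<Rightarrow> (('a \<Rightarrow> real) \<Rightarrow> real) \<Rightarrow> ('a \<Rightarrow> real) \<Rightarrow> real" where
  "oc_part_pos M \<Phi> f u =
     oc_part_cone M \<Phi> f (\<lambda>t. max (u t) 0) - oc_part_cone M \<Phi> f (\<lambda>t. max (- u t) 0)"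

definition order_continuous_part ::
  "'a measure \<Rightarrow> ('a \<Rightarrow> ennreal \<Rightarrow> ennreal) \<Rightarrow> (('a \<Rightarrow> real) \<Rightarrow> real) \<Rightarrow> ('a \<Rightarrow> real) \<Rightarrow> real" where
  "order_continuous_part M \<Phi> f u =
     oc_part_pos M \<Phi> (functional_pos_part M \<Phi> f) u
       - oc_part_pos M \<Phi> (functional_pos_part M \<Phi> (\<lambda>w. - f w)) u"

definition purely_singular ::
  "'a measure \<Rightarrow> ('a \<Rightarrow> ennreal \<Rightarrow> ennreal) \<Rightarrow> (('a \<Rightarrow> real) \<Rightarrow> real) \<Rightarrow> bool" where
  "purely_singular M \<Phi> f \<longleftrightarrow>
     f \<in> orlicz_dual M \<Phi> \<and> (\<forall>u\<in>orlicz_space M \<Phi>. order_continuous_part M \<Phi> f u = 0)"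

definition support_functional ::
  "'a measure \<Rightarrow> ('a \<Rightarrow> ennreal \<Rightarrow> ennreal) \<Rightarrow> ('a \<Rightarrow> real) \<Rightarrow> (('a \<Rightarrow> real) \<Rightarrow> real) \<Rightarrow> bool" where
  "support_functional M \<Phi> u f \<longleftrightarrow>
     f \<in> orlicz_dual M \<Phi> \<and> dual_norm M \<Phi> f = 1 \<and> f u = orlicz_norm M \<Phi> u"

definition supp :: "'a measure \<Rightarrow> ('a \<Rightarrow> real) \<Rightarrow> 'a set" where
  "supp M u = {t \<in> space M. \<bar>u t\<bar> > 0}"

end

theory Submission
  imports Defs
begin

text \<open>If the infimum over \<open>k\<close> of \<open>(1 + I (k u)) / k\<close> is not attained, it is approached along
  some \<open>k\<close> tending to infinity. Hence \<open>I (k u)\<close> is finite for all \<open>k\<close>, so that singular functionals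
  vanish at \<open>u\<close>, and Fatou's lemma together with Young's inequality gives
  \<open>\<parallel>u\<parallel> = \<integral> \<bar>u\<bar> b\<close>. On the other hand a functional \<open>\<integral> w v + f\<^sub>s w\<close> has norm at most 1 iff
  \<open>I\<^sup>* v + \<parallel>f\<^sub>s\<parallel> \<le> 1\<close>, because a singular functional does not see what happens off sets on which a
  given integrable function has small integral. Since \<open>I\<^sup>* v < \<infinity>\<close> forces \<open>\<bar>v\<bar> \<le> b\<close>, the equality
  \<open>\<integral> u v = \<integral> \<bar>u\<bar> b\<close> is equivalent to \<open>v = sgn u b\<close> on the support of \<open>u\<close>. That the Orlicz norm
  is the Amemiya norm is Lagrange duality for the single constraint \<open>I\<^sup>* v \<le> 1\<close>.\<close>

section \<open>Young functions and their conjugates\<close>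

text \<open>The Lagrange step yields an inequality between integrals for every admissible
  \<open>v\<close>, whereas the Amemiya expression contains the integral of a pointwise supremum.
  Exchanging supremum and integral is a main obstacle; it is met by taking suprema over rational
  arguments only, so that nearly optimal values can be selected measurably. The pointwise supremum
  of \<open>|w| q - c \<Psi> q\<close> dominates \<open>c \<Phi> (|w| / c)\<close> by biconjugation,
  where convexity and lower semicontinuity of \<Phi> enter, and the Amemiya parameter is
  \<open>k = 1 / c\<close>. The same selection recovers \<open>J v\<close> from the pairings of
  \<open>v\<close> when a norm bound is converted into a bound on \<open>J v\<close>. A second
  obstacle is that pure singularity is given only as a cancellation between the order continuous
  parts of the positive and negative parts of the functional; it is first turned into a statement
  about sets that supports the cutting and pasting of test functions.\<close>

lemma complementary_mono:
  assumes "x \<le> y"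
  shows "complementary \<Phi> t x \<le> complementary \<Phi> t y"
  unfolding complementary_def
  by (intro SUP_mono' ennreal_minus_mono mult_left_mono assms) auto

lemma complementary_0 [simp]: "complementary \<Phi> t 0 = 0"
  by (simp add: complementary_def)

text \<open>A supremum of affine functions: average Young's inequality at \<open>x\<close> and at
  \<open>y\<close> for each fixed \<open>u\<close>. Finiteness of \<open>x\<close> and
  \<open>y\<close> rules out \<open>top - top\<close>, which equals \<open>top\<close> in
  \<open>ennreal\<close>.\<close>

lemma complementary_convex:
  assumes l: "0 \<le> l" "l \<le> (1::real)" and fin: "x \<noteq> \<infinity>" "y \<noteq> \<infinity>"
  shows "complementary \<Phi> t (ennreal l * x + ennreal (1 - l) * y)
           \<le> ennreal l * complementary \<Phi> t x + ennreal (1 - l) * complementary \<Phi> t y"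
  unfolding complementary_def[of _ _ "ennreal l * x + ennreal (1 - l) * y"]
proof (rule SUP_least)
  fix u :: ennreal assume u: "u \<in> {0<..<\<infinity>}"
  have c: "u * z \<le> \<Phi> t u + complementary \<Phi> t z" for z
  proof -
    have "u * z - \<Phi> t u \<le> complementary \<Phi> t z"
      unfolding complementary_def by (intro SUP_upper u)
    then show ?thesis by (metis add.commute ennreal_minus_le_iff)
  qed
  have "u * (ennreal l * x + ennreal (1 - l) * y) = ennreal l * (u * x) + ennreal (1 - l) * (u * y)"
    by (simp add: algebra_simps)
  also have "\<dots> \<le> ennreal l * (\<Phi> t u + complementary \<Phi> t x) + ennreal (1 - l) * (\<Phi> t u + complementary \<Phi> t y)"
    by (intro add_mono mult_left_mono c) auto
  also have "\<dots> = (ennreal l + ennreal (1 - l)) * \<Phi> t u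
      + (ennreal l * complementary \<Phi> t x + ennreal (1 - l) * complementary \<Phi> t y)"
    by (simp add: algebra_simps)
  also have "ennreal l + ennreal (1 - l) = 1"
    using l by (simp flip: ennreal_plus)
  finally show "u * (ennreal l * x + ennreal (1 - l) * y) - \<Phi> t u
      \<le> ennreal l * complementary \<Phi> t x + ennreal (1 - l) * complementary \<Phi> t y"
    using u fin by (auto simp: ennreal_minus_le_iff add.commute ennreal_mult_eq_top_iff)
qed

lemma complementary_young:
  "ennreal a * y \<le> \<Phi> t (ennreal a) + complementary \<Phi> t y"
proof (cases "a > 0")
  case True
  have "ennreal a * y - \<Phi> t (ennreal a) \<le> complementary \<Phi> t y"
    unfolding complementary_def by (intro SUP_upper) (use True in auto)
  then show ?thesis by (metis add.commute ennreal_minus_le_iff)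
qed (simp add: ennreal_neg)

text \<open>Converse of Young's inequality: a subtraction-free estimate for real arguments bounds
  the conjugate. Finiteness of \<open>y\<close> again avoids \<open>top - top\<close>.\<close>

lemma complementary_leI:
  assumes "\<And>a. a > 0 \<Longrightarrow> ennreal a * y \<le> \<Phi> t (ennreal a) + c" "y \<noteq> \<infinity>"
  shows "complementary \<Phi> t y \<le> c"
  unfolding complementary_def
proof (rule SUP_least)
  fix u :: ennreal assume u: "u \<in> {0<..<\<infinity>}"
  then obtain a where "u = ennreal a" "a > 0"
    by (cases u) (auto simp: ennreal_less_zero_iff)
  with assms(1)[of a] assms(2) show "u * y - \<Phi> t u \<le> c"
    by (simp add: ennreal_minus_le_iff add.commute ennreal_mult_eq_top_iff)
qed

section \<open>Affine minorants and biconjugation of a single Young function\<close>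

locale young_function =
  fixes \<phi> :: "ennreal \<Rightarrow> ennreal"
  assumes convex: "convex_ennreal \<phi>"
    and lsc: "lower_semicontinuous_ennreal \<phi>"
    and zero [simp]: "\<phi> 0 = 0"
    and infinity [simp]: "\<phi> \<infinity> = \<infinity>"
begin

lemma convexD:
  assumes "0 \<le> l" "l \<le> (1::real)"
  shows "\<phi> (ennreal l * x + ennreal (1 - l) * y) \<le> ennreal l * \<phi> x + ennreal (1 - l) * \<phi> y"
  using convex assms by (auto simp: convex_ennreal_def)

lemma scale:
  assumes "0 \<le> l" "l \<le> (1::real)"
  shows "\<phi> (ennreal l * x) \<le> ennreal l * \<phi> x"
  using convexD[OF assms, of x 0] by simp

text \<open>Convexity along the segment from 0 to \<open>y\<close>, where \<phi> vanishes at 0,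
  gives \<open>\<phi> x <= (a / b) \<phi> y\<close> for finite
  \<open>x = a <= b = y\<close>.\<close>

lemma mono:
  assumes "x \<le> y"
  shows "\<phi> x \<le> \<phi> y"
proof (cases "y = \<infinity> \<or> y = 0")
  case True
  then show ?thesis using assms infinity by (auto simp: infinity_ennreal_def)
next
  case False
  then obtain a b where ab: "y = ennreal b" "b > 0" "x = ennreal a" "0 \<le> a" "a \<le> b"
    using assms by (cases x; cases y) (auto simp: ennreal_le_iff top_unique)
  have "\<phi> x = \<phi> (ennreal (a / b) * y)"
    using ab by (simp flip: ennreal_mult)
  also have "\<dots> \<le> ennreal (a / b) * \<phi> y"
    by (rule scale) (use ab in auto)
  also have "\<dots> \<le> 1 * \<phi> y"
    by (rule mult_right_mono) (use ab in auto)
  finally show ?thesis by simp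
qed

text \<open>With monotonicity this is left-continuity, the form in which lower semicontinuity at
  finite points is used.\<close>

lemma less_left:
  assumes "r < \<phi> (ennreal a)"
  obtains s where "0 < s" "s < a" "r < \<phi> (ennreal s)"
proof -
  have a: "a > 0"
    using assms by (cases "a > 0") (auto simp: ennreal_neg)
  have "r < Liminf (at (ennreal a)) \<phi>"
    using lsc assms unfolding lower_semicontinuous_ennreal_def by (meson less_le_trans)
  then have "eventually (\<lambda>x. r < \<phi> x) (at (ennreal a))"
    by (rule less_LiminfD)
  then have "eventually (\<lambda>x. r < \<phi> x) (at_left (ennreal a))"
    by (metis at_le filter_leD subset_UNIV)
  then obtain b where b: "b < ennreal a" "\<And>y. b < y \<Longrightarrow> y < ennreal a \<Longrightarrow> r < \<phi> y"
    using eventually_at_left[of 0 "ennreal a"] a by (auto simp: ennreal_less_zero_iff)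
  obtain y where y: "b < y" "y < ennreal a" using dense[OF b(1)] by auto
  have "y < \<infinity>" "0 < y"
    using y by (auto simp: less_top intro: le_less_trans less_le_trans)
  then obtain s where s: "y = ennreal s" "s > 0"
    by (cases y) (auto simp: ennreal_less_zero_iff)
  with y b show ?thesis
    by (intro that[of s]) (auto simp: ennreal_less_iff)
qed


text \<open>The slope of the chord over \<open>[s, a]\<close> with \<open>r < \<phi> s\<close> is a witness: the affine function with
  this slope and value \<open>\<phi> s\<close> at \<open>a\<close> lies below \<open>\<phi>\<close>.\<close>

lemma ex_affine_minorant_finite:
  assumes r: "ennreal r < \<phi> (ennreal a)" "\<phi> (ennreal a) < \<infinity>" "0 \<le> r"
  shows "\<exists>q\<ge>0. \<forall>u\<ge>0. ennreal (r + u * q) \<le> \<phi> (ennreal u) + ennreal (a * q)"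
proof -
  obtain s where s: "0 < s" "s < a" "ennreal r < \<phi> (ennreal s)"
    using less_left[OF r(1)] .
  have "\<phi> (ennreal s) \<le> \<phi> (ennreal a)" by (rule mono) (use s in \<open>auto simp: ennreal_le_iff\<close>)
  with r(2) obtain S A where SA: "\<phi> (ennreal s) = ennreal S" "\<phi> (ennreal a) = ennreal A" "0 \<le> S" "S \<le> A"
    by (cases "\<phi> (ennreal s)"; cases "\<phi> (ennreal a)") (auto simp: ennreal_le_iff top_unique)
  define q where "q = (A - S) / (a - s)"
  have q: "q \<ge> 0" "q * (a - s) = A - S" using SA s by (auto simp: q_def)
  have rS: "r < S" using s(3) SA r(3) by (simp add: ennreal_less_iff)
  have "ennreal (r + u * q) \<le> \<phi> (ennreal u) + ennreal (a * q)" if u: "u \<ge> 0" for u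
  proof (cases "\<phi> (ennreal u) = \<infinity>")
    case True
    then show ?thesis by simp
  next
    case False
    then obtain U where U: "\<phi> (ennreal u) = ennreal U" "0 \<le> U" by (cases "\<phi> (ennreal u)") auto
    have conv: "\<phi> (ennreal (l * x + (1 - l) * y)) \<le> ennreal (l * X + (1 - l) * Y)"
      if "0 \<le> l" "l \<le> 1" "0 \<le> x" "0 \<le> y" "\<phi> (ennreal x) = ennreal X" "\<phi> (ennreal y) = ennreal Y"
         "0 \<le> X" "0 \<le> Y" for l x y X Y
      using convexD[of l "ennreal x" "ennreal y"] that by (simp flip: ennreal_mult ennreal_plus)
    \<comment> \<open>Outside \<open>[s, a]\<close> a convex graph lies above the line through the
      endpoints of the chord; inside, monotonicity gives \<open>r < S <= U\<close>, while the term
      in \<open>q\<close> has the right sign.\<close>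
    consider "u \<le> s" | "s < u" "u \<le> a" | "a < u" by linarith
    then have "r + u * q \<le> U + a * q"
    proof cases
      case 1
      \<comment> \<open>The weight that makes \<open>s\<close> the convex combination of
        \<open>u\<close> and \<open>a\<close>.\<close>
      define l where "l = (a - s) / (a - u)"
      have l: "0 \<le> l" "l \<le> 1" using 1 s by (auto simp: l_def)
      have "l * (a - u) = a - s" using 1 s by (simp add: l_def)
      then have ls: "l * u + (1 - l) * a = s" by (simp add: algebra_simps)
      have "S \<le> l * U + (1 - l) * A"
        using conv[OF l _ _ U(1) SA(2)] u s SA U l unfolding ls
          by (simp add: ennreal_le_iff flip: ennreal_plus)
      then have "l * (A - U) \<le> A - S" by (simp add: algebra_simps)
      then have "l * (A - U) \<le> q * (l * (a - u))" unfolding \<open>l * (a - u) = a - s\<close> q .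
      moreover have "l > 0" using 1 s by (auto simp: l_def)
      ultimately have "A - U \<le> q * (a - u)"
        by (metis mult.left_commute mult_le_cancel_left_pos)
      then show ?thesis using rS SA by (simp add: algebra_simps)
    next
      case 2
      have "\<phi> (ennreal s) \<le> \<phi> (ennreal u)" by (rule mono) (use s 2 in \<open>auto simp: ennreal_le_iff\<close>)
      then have "S \<le> U" using SA U by (simp add: ennreal_le_iff)
      moreover have "u * q \<le> a * q" using 2 q by (simp add: mult_right_mono)
      ultimately show ?thesis using rS by linarith
    next
      case 3
      \<comment> \<open>The weight that makes \<open>a\<close> the convex combination of
        \<open>s\<close> and \<open>u\<close>.\<close>
      define l where "l = (u - a) / (u - s)"
      have l: "0 \<le> l" "l \<le> 1" using 3 s by (auto simp: l_def)
      have "l * (u - s) = u - a" using 3 s by (simp add: l_def)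
      then have ls: "l * s + (1 - l) * u = a" by (simp add: algebra_simps)
      have le: "A \<le> l * S + (1 - l) * U"
        using conv[OF l _ _ SA(1) U(1)] u s SA U l unfolding ls
          by (simp add: ennreal_le_iff flip: ennreal_plus)
      have "\<phi> (ennreal a) \<le> \<phi> (ennreal u)" by (rule mono) (use s 3 in \<open>auto simp: ennreal_le_iff\<close>)
      then have "A \<le> U" using SA U by (simp add: ennreal_le_iff)
      have "(1 - l) * (u - s) = a - s" using \<open>l * (u - s) = u - a\<close> by (simp add: algebra_simps)
      then have "(1 - l) * (q * (u - s)) = A - S" using q by (metis mult.left_commute)
      also have "\<dots> \<le> (1 - l) * (U - S)" using le by (simp add: algebra_simps)
      finally have "q * (u - s) \<le> U - S"
        using 3 s by (simp add: l_def divide_simps mult_le_cancel_left)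
      then show ?thesis using rS q SA(4) by (simp add: algebra_simps)
    qed
    then show ?thesis
      using U q s u r by (simp flip: ennreal_plus add: ennreal_le_iff)
  qed
  with q show ?thesis by auto
qed

text \<open>Here \<phi> may be infinite at \<open>a\<close>. Stepping left to \<open>s\<close>
  either reaches a finite value, and the minorant found there has slope at least 0 and also serves
  \<open>a\<close>, or \<phi> is infinite from \<open>s\<close> on.\<close>

lemma ex_affine_minorant:
  assumes r: "ennreal r < \<phi> (ennreal a)" "0 \<le> r"
  shows "\<exists>q\<ge>0. \<forall>u\<ge>0. ennreal (r + u * q) \<le> \<phi> (ennreal u) + ennreal (a * q)"
proof -
  obtain s where s: "0 < s" "s < a" "ennreal r < \<phi> (ennreal s)"
    using less_left[OF r(1)] .
  show ?thesis
  proof (cases "\<phi> (ennreal s) < \<infinity>")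
    case True
    then obtain q where q: "q \<ge> 0" "\<And>u. u \<ge> 0 \<Longrightarrow> ennreal (r + u * q) \<le> \<phi> (ennreal u) + ennreal (s * q)"
      using ex_affine_minorant_finite[OF s(3) True r(2)] by blast
    have "\<phi> (ennreal u) + ennreal (s * q) \<le> \<phi> (ennreal u) + ennreal (a * q)" for u
      using s q by (intro add_mono order_refl ennreal_leI mult_right_mono) auto
    with q show ?thesis by (blast intro: order_trans)
  next
    case False
    \<comment> \<open>The line with value \<open>r\<close> at \<open>a\<close> and value 0 at
      \<open>s\<close>: it is at most 0 up to \<open>s\<close>, and \<phi> is infinite
      beyond.\<close>
    define q where "q = r / (a - s)"
    have q: "q \<ge> 0" "q * (a - s) = r" using s r by (auto simp: q_def)
    have "ennreal (r + u * q) \<le> \<phi> (ennreal u) + ennreal (a * q)" if u: "u \<ge> 0" for u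
    proof (cases "u \<le> s")
      case True
      then have "u * q \<le> s * q" using q by (simp add: mult_right_mono)
      then have "r + u * q \<le> a * q" using q by (simp add: algebra_simps)
      then show ?thesis by (simp add: ennreal_leI add_increasing)
    next
      case F: False
      then have "\<phi> (ennreal s) \<le> \<phi> (ennreal u)" by (intro mono ennreal_leI) auto
      with False have "\<phi> (ennreal u) = top" by (metis infinity_ennreal_def less_top top_unique)
      then show ?thesis by simp
    qed
    with q show ?thesis by auto
  qed
qed

text \<open>The nontrivial half of biconjugation: every value below \<open>\<phi> a\<close> is
  exceeded by some \<open>a q\<close> minus the conjugate at \<open>q\<close>. A rational
  \<open>q\<close> makes the resulting suprema countable.\<close>

lemma fenchel_moreau:
  assumes "ennreal r < \<phi> (ennreal a)" "0 \<le> r"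
  shows "\<exists>q\<in>\<rat>. q \<ge> 0 \<and> ennreal r + complementary (\<lambda>_. \<phi>) t (ennreal q) < ennreal (a * q)"
proof -
  have a: "a > 0" using assms by (cases "a > 0") (auto simp: ennreal_neg)
  \<comment> \<open>The gap between \<open>r\<close> and \<open>r'\<close> pays for moving the slope
    \<open>p\<close> down to a rational one.\<close>
  obtain r' where r': "r < r'" "ennreal r' < \<phi> (ennreal a)"
  proof -
    obtain y where y: "ennreal r < y" "y < \<phi> (ennreal a)" using dense[OF assms(1)] by auto
    then have "y < \<infinity>" by (auto simp: less_top intro: less_le_trans)
    then show ?thesis using y assms(2) that by (cases y) (auto simp: ennreal_less_iff)
  qed
  then obtain p where p: "p \<ge> 0" "\<And>u. u \<ge> 0 \<Longrightarrow> ennreal (r' + u * p) \<le> \<phi> (ennreal u) + ennreal (a * p)"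
    using ex_affine_minorant[of r' a] assms(2) by force
  have ap: "r' \<le> a * p" using p(2)[of 0] p(1) a by (simp add: ennreal_le_iff)
  then have "p > 0" using r' assms(2) a p(1) by (cases "p = 0") auto
  \<comment> \<open>An affine minorant of slope \<open>p\<close> is the same thing as a bound on the
    conjugate at \<open>p\<close>.\<close>
  have *: "complementary (\<lambda>_. \<phi>) t (ennreal p) \<le> ennreal (a * p - r')"
  proof (rule complementary_leI)
    fix u :: real assume u: "u > 0"
    show "ennreal u * ennreal p \<le> \<phi> (ennreal u) + ennreal (a * p - r')"
    proof (cases "\<phi> (ennreal u)")
      case (real U)
      have "r' + u * p \<le> U + a * p"
        using p(2)[of u] u p(1) real r' assms(2) a by (simp flip: ennreal_plus add: ennreal_le_iff)
      then show ?thesis using real u p(1) ap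
        by (simp flip: ennreal_plus ennreal_mult add: ennreal_le_iff)
    qed simp
  qed simp
  \<comment> \<open>Any \<open>q\<close> in this interval is positive and satisfies
    \<open>a * (p - q) < r' - r\<close>; the conjugate does not increase from \<open>p\<close> to
    \<open>q\<close>.\<close>
  have "max 0 (p - (r' - r) / a) < p" using \<open>p > 0\<close> r' a by auto
  then obtain q where q: "q \<in> \<rat>" "max 0 (p - (r' - r) / a) < q" "q < p"
    using Rats_dense_in_real by blast
  then have "p - q < (r' - r) / a" by simp
  then have aq: "r + (a * p - r') < a * q" using a by (simp add: field_simps)
  have "ennreal r + complementary (\<lambda>_. \<phi>) t (ennreal q) \<le> ennreal r + complementary (\<lambda>_. \<phi>) t (ennreal p)"
    using q by (intro add_mono order_refl complementary_mono ennreal_leI) auto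
  also have "\<dots> \<le> ennreal r + ennreal (a * p - r')" by (intro add_mono order_refl *)
  also have "\<dots> = ennreal (r + (a * p - r'))" using assms ap by (simp flip: ennreal_plus)
  also have "\<dots> < ennreal (a * q)" using aq assms ap a by (intro ennreal_lessI) (auto intro: le_less_trans)
  finally show ?thesis using q by (intro bexI[of _ q]) auto
qed

end

section \<open>Measurability and measurable selection\<close>

text \<open>Supremum and integral can be exchanged because there are countably many candidates: the
  best among the first \<open>n\<close> is measurable in \<open>t\<close>, and monotone convergence
  makes it nearly optimal in the integral. Here \<open>c t * q\<close> is a reward and
  \<open>\<Psi> t q\<close> a penalty.\<close>

lemma (in sigma_finite_measure) ex_measurable_selection:
  fixes \<Psi> :: "'a \<Rightarrow> real \<Rightarrow> ennreal" and c :: "'a \<Rightarrow> real"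
  assumes \<Psi> [measurable]: "\<And>q. (\<lambda>t. \<Psi> t q) \<in> borel_measurable M"
    and \<Psi>0: "\<And>t. \<Psi> t 0 = 0"
    and c [measurable]: "c \<in> borel_measurable M"
    and r: "r < (\<integral>\<^sup>+ t. (SUP q\<in>\<rat> \<inter> {0..}. ennreal (c t * q) - \<Psi> t q) \<partial>M)"
  obtains x where "x \<in> borel_measurable M" "\<And>t. 0 \<le> x t"
    "(\<integral>\<^sup>+ t. \<Psi> t (x t) \<partial>M) < \<infinity>"
    "r + (\<integral>\<^sup>+ t. \<Psi> t (x t) \<partial>M) < (\<integral>\<^sup>+ t. ennreal (c t * x t) \<partial>M)"
proof -
  have Q: "countable (\<rat> \<inter> {0::real..})" "\<rat> \<inter> {0::real..} \<noteq> {}"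
    by (auto intro: countable_rat)
  define e where "e = from_nat_into (\<rat> \<inter> {0::real..})"
  have range_e: "range e = \<rat> \<inter> {0..}" unfolding e_def by (rule range_from_nat_into[OF Q(2,1)])
  \<comment> \<open>\<open>y n t\<close> is the best of 0 and \<open>e 0, ..., e (n - 1)\<close>;
    the start value 0 has reward and penalty 0.\<close>
  define y where "y = rec_nat (\<lambda>t. 0)
    (\<lambda>n z t. if ennreal (c t * z t) - \<Psi> t (z t) < ennreal (c t * e n) - \<Psi> t (e n) then e n else z t)"
  define g where "g n t = ennreal (c t * y n t) - \<Psi> t (y n t)" for n t
  have y0: "y 0 = (\<lambda>t. 0)" by (simp add: y_def)
  have ySuc: "y (Suc n) t = (if g n t < ennreal (c t * e n) - \<Psi> t (e n) then e n else y n t)" for n t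
    by (simp add: y_def g_def)
  have e0: "e n \<ge> 0" for n using range_e by (metis IntD2 UNIV_I atLeast_iff image_eqI)
  have y_nonneg: "y n t \<ge> 0" for n t by (induction n) (auto simp: y0 ySuc e0)
  have meas: "y n \<in> borel_measurable M \<and> (\<lambda>t. \<Psi> t (y n t)) \<in> borel_measurable M" for n
  proof (induction n)
    case 0
    then show ?case by (simp add: y0)
  next
    case (Suc n)
    then have [measurable]: "y n \<in> borel_measurable M" "(\<lambda>t. \<Psi> t (y n t)) \<in> borel_measurable M" by auto
    have [measurable]: "g n \<in> borel_measurable M" unfolding g_def by measurable
    have "y (Suc n) = (\<lambda>t. if g n t < ennreal (c t * e n) - \<Psi> t (e n) then e n else y n t)"
      by (auto simp: ySuc)
    moreover have "(\<lambda>t. \<Psi> t (y (Suc n) t)) =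
        (\<lambda>t. if g n t < ennreal (c t * e n) - \<Psi> t (e n) then \<Psi> t (e n) else \<Psi> t (y n t))"
      by (auto simp: ySuc)
    moreover have "(\<lambda>t. if g n t < ennreal (c t * e n) - \<Psi> t (e n) then e n else y n t) \<in> borel_measurable M"
      by measurable
    moreover have "(\<lambda>t. if g n t < ennreal (c t * e n) - \<Psi> t (e n) then \<Psi> t (e n) else \<Psi> t (y n t)) \<in> borel_measurable M"
      by measurable
    ultimately show ?case by simp
  qed
  then have [measurable]: "y n \<in> borel_measurable M" "(\<lambda>t. \<Psi> t (y n t)) \<in> borel_measurable M" for n by auto
  have [measurable]: "g n \<in> borel_measurable M" for n unfolding g_def by measurable
  \<comment> \<open>A new candidate is accepted only for a strictly positive gain, so the penalty
    never exceeds the reward. Hence the truncated difference plus the penalty gives back the reward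
    exactly.\<close>
  have \<Psi>_le: "\<Psi> t (y n t) \<le> ennreal (c t * y n t)" for n t
  proof (induction n)
    case 0
    then show ?case by (simp add: y0 \<Psi>0)
  next
    case (Suc n)
    have "\<Psi> t (e n) \<le> ennreal (c t * e n)" if "g n t < ennreal (c t * e n) - \<Psi> t (e n)"
    proof (rule ccontr)
      assume "\<not> ?thesis"
      then have "ennreal (c t * e n) - \<Psi> t (e n) = 0" by (intro diff_eq_0_ennreal) (auto simp: less_top)
      with that show False by simp
    qed
    with Suc show ?case by (auto simp: ySuc)
  qed
  have gSuc: "g (Suc n) t = max (g n t) (ennreal (c t * e n) - \<Psi> t (e n))" for n t
    unfolding g_def[of "Suc n"] ySuc by (auto simp: g_def max_def)
  have inc: "incseq g"
    by (rule incseq_SucI) (auto simp: le_fun_def gSuc)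
  have "(SUP q\<in>\<rat> \<inter> {0..}. ennreal (c t * q) - \<Psi> t q) \<le> (SUP n. g n t)" for t
  proof (rule SUP_least)
    fix q :: real assume "q \<in> \<rat> \<inter> {0..}"
    then obtain n where "q = e n" using range_e by (metis imageE)
    then have "ennreal (c t * q) - \<Psi> t q \<le> g (Suc n) t" by (simp add: gSuc)
    also have "\<dots> \<le> (SUP n. g n t)" by (rule SUP_upper) simp
    finally show "ennreal (c t * q) - \<Psi> t q \<le> (SUP n. g n t)" .
  qed
  then have "(\<integral>\<^sup>+ t. (SUP q\<in>\<rat> \<inter> {0..}. ennreal (c t * q) - \<Psi> t q) \<partial>M) \<le> (\<integral>\<^sup>+ t. (SUP n. g n t) \<partial>M)"
    by (rule nn_integral_mono)
  also have "\<dots> = (SUP n. \<integral>\<^sup>+ t. g n t \<partial>M)"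
    by (rule nn_integral_monotone_convergence_SUP[OF inc]) simp
  finally obtain n where n: "r < (\<integral>\<^sup>+ t. g n t \<partial>M)"
    using less_le_trans[OF r] by (metis (no_types, lifting) less_SUP_iff)
  obtain A :: "nat \<Rightarrow> 'a set" where A: "range A \<subseteq> sets M" "(\<Union>i. A i) = space M"
    "\<And>i. emeasure M (A i) \<noteq> \<infinity>" "incseq A"
    using sigma_finite_incseq by metis
  have [measurable]: "A i \<in> sets M" for i using A(1) by auto
  \<comment> \<open>Nothing so far makes the penalty of \<open>y n\<close> integrable. Replacing
    \<open>y n\<close> by 0 off a set of finite measure with bounded penalty does, and a second
    monotone convergence shows that the loss is harmless.\<close>
  define B where "B m = {t \<in> space M. t \<in> A m \<and> \<Psi> t (y n t) \<le> of_nat m}" for m :: nat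
  have [measurable]: "B m \<in> sets M" for m unfolding B_def by measurable
  have incB: "incseq B"
    using \<open>incseq A\<close> by (fastforce simp: incseq_def B_def intro: order_trans)
  have "(SUP m. g n t * indicator (B m) t) = g n t" if t: "t \<in> space M" for t
  proof (rule antisym)
    show "(SUP m. g n t * indicator (B m) t) \<le> g n t"
      by (intro SUP_least) (simp add: indicator_def)
    obtain i where i: "t \<in> A i" using t A(2) by auto
    have "\<Psi> t (y n t) < top" using le_less_trans[OF \<Psi>_le[of t n] ennreal_less_top] .
    then obtain j where j: "\<Psi> t (y n t) \<le> of_nat j"
      using ennreal_Ex_less_of_nat less_imp_le by blast
    have "A i \<subseteq> A (max i j)" using \<open>incseq A\<close> by (simp add: incseq_def)
    then have "t \<in> B (max i j)"
      using i j t \<open>incseq A\<close> by (auto simp: B_def of_nat_max le_max_iff_disj intro: order_trans)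
    then have "g n t = g n t * indicator (B (max i j)) t" by simp
    also have "\<dots> \<le> (SUP m. g n t * indicator (B m) t)" by (rule SUP_upper) simp
    finally show "g n t \<le> (SUP m. g n t * indicator (B m) t)" .
  qed
  then have "(\<integral>\<^sup>+ t. g n t \<partial>M) = (\<integral>\<^sup>+ t. (SUP m. g n t * indicator (B m) t) \<partial>M)"
    by (intro nn_integral_cong) simp
  also have "\<dots> = (SUP m. \<integral>\<^sup>+ t. g n t * indicator (B m) t \<partial>M)"
  proof (rule nn_integral_monotone_convergence_SUP)
    show "incseq (\<lambda>m t. g n t * indicator (B m) t)"
      using incB by (auto simp: incseq_def le_fun_def indicator_def)
  qed simp
  finally obtain m where m: "r < (\<integral>\<^sup>+ t. g n t * indicator (B m) t \<partial>M)"
    using n by (auto simp: less_SUP_iff)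
  define x where "x t = y n t * indicator (B m) t" for t
  have \<Psi>x: "\<Psi> t (x t) = \<Psi> t (y n t) * indicator (B m) t" for t
    by (auto simp: x_def \<Psi>0 indicator_def)
  have "(\<integral>\<^sup>+ t. \<Psi> t (x t) \<partial>M) \<le> (\<integral>\<^sup>+ t. of_nat m * indicator (A m) t \<partial>M)"
    by (intro nn_integral_mono) (auto simp: \<Psi>x B_def indicator_def)
  also have "\<dots> = of_nat m * emeasure M (A m)" by (simp add: nn_integral_cmult)
  also have "\<dots> < \<infinity>" using A(3)[of m] by (simp add: ennreal_mult_less_top less_top of_nat_less_top)
  finally have fin: "(\<integral>\<^sup>+ t. \<Psi> t (x t) \<partial>M) < \<infinity>" .
  have "ennreal (c t * x t) = g n t * indicator (B m) t + \<Psi> t (x t)" for t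
    unfolding \<Psi>x using \<Psi>_le[of t n] by (auto simp: x_def g_def indicator_def diff_add_cancel_ennreal)
  then have "(\<integral>\<^sup>+ t. ennreal (c t * x t) \<partial>M) = (\<integral>\<^sup>+ t. g n t * indicator (B m) t \<partial>M) + (\<integral>\<^sup>+ t. \<Psi> t (x t) \<partial>M)"
    unfolding \<Psi>x by (simp add: nn_integral_add)
  then have "r + (\<integral>\<^sup>+ t. \<Psi> t (x t) \<partial>M) < (\<integral>\<^sup>+ t. ennreal (c t * x t) \<partial>M)"
    using m fin by (simp add: add.commute[of _ "\<integral>\<^sup>+ t. \<Psi> t (x t) \<partial>M"] ennreal_add_left_cancel_less less_top)
  moreover have "x \<in> borel_measurable M" unfolding x_def by measurable
  moreover have "\<And>t. 0 \<le> x t" by (auto simp: x_def y_nonneg)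
  ultimately show ?thesis using fin that by blast
qed

text \<open>The Young conditions are imposed at every point rather than almost everywhere;
  \<open>proposition10\<close> reduces to this case.\<close>

locale musielak_orlicz_space = sigma_finite_measure M for M :: "'a measure" +
  fixes \<Phi> :: "'a \<Rightarrow> ennreal \<Rightarrow> ennreal"
  assumes young: "young_function (\<Phi> t)"
    and section_measurable: "u \<ge> 0 \<Longrightarrow> (\<lambda>t. \<Phi> t (ennreal u)) \<in> borel_measurable M"
begin

lemmas \<Phi>_mono = young_function.mono[OF young]
  and \<Phi>_0 [simp] = young_function.zero[OF young]
  and \<Phi>_convex = young_function.convexD[OF young]
  and \<Phi>_less_left = young_function.less_left[OF young]

abbreviation "\<Psi> \<equiv> complementary \<Phi>"

text \<open>Left-continuity gives a countable supremum in which \<open>a\<close> occurs only in the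
  test \<open>q < a\<close>. Measurability of the sections therefore yields measurability after
  inserting a measurable function for \<open>a\<close>.\<close>

lemma \<Phi>_conv_SUP:
  "\<Phi> t (ennreal a) = (SUP q\<in>\<rat>. if q < a then \<Phi> t (ennreal q) else 0)"
proof (rule antisym)
  show "\<Phi> t (ennreal a) \<le> (SUP q\<in>\<rat>. if q < a then \<Phi> t (ennreal q) else 0)"
  proof (rule dense_le)
    fix r assume "r < \<Phi> t (ennreal a)"
    from \<Phi>_less_left[OF this] obtain s where s: "s < a" "r < \<Phi> t (ennreal s)" by metis
    obtain q where q: "q \<in> \<rat>" "s < q" "q < a" using Rats_dense_in_real[OF s(1)] by auto
    have "r \<le> \<Phi> t (ennreal q)"
      using s(2) \<Phi>_mono[of "ennreal s" "ennreal q" t] q by (auto simp: ennreal_leI)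
    also have "\<dots> \<le> (SUP q\<in>\<rat>. if q < a then \<Phi> t (ennreal q) else 0)"
      by (rule SUP_upper2[OF q(1)]) (use q in auto)
    finally show "r \<le> \<dots>" .
  qed
  show "(SUP q\<in>\<rat>. if q < a then \<Phi> t (ennreal q) else 0) \<le> \<Phi> t (ennreal a)"
    by (rule SUP_least) (auto intro!: \<Phi>_mono ennreal_leI)
qed

lemma section_measurable' [measurable]: "(\<lambda>t. \<Phi> t (ennreal u)) \<in> borel_measurable M"
  by (cases "u \<ge> 0") (auto simp: section_measurable ennreal_neg)

lemma \<Phi>_measurable [measurable (raw)]:
  assumes [measurable]: "x \<in> borel_measurable M"
  shows "(\<lambda>t. \<Phi> t (ennreal (x t))) \<in> borel_measurable M"
proof -
  have "(\<lambda>t. SUP q\<in>\<rat>. if q < x t then \<Phi> t (ennreal q) else 0) \<in> borel_measurable M"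
    using countable_rat by measurable
  then show ?thesis by (simp only: \<Phi>_conv_SUP[of _ "x _", symmetric])
qed

text \<open>Rational arguments suffice: replacing \<open>a\<close> by a slightly smaller rational
  changes \<open>a * b\<close> little and does not increase \<Phi>.\<close>

lemma \<Psi>_conv_SUP:
  "\<Psi> t (ennreal b) = (SUP q\<in>\<rat> \<inter> {0..}. ennreal (q * b) - \<Phi> t (ennreal q))" (is "_ = ?S")
proof (rule antisym)
  show "\<Psi> t (ennreal b) \<le> ?S"
  proof (rule complementary_leI)
    fix a :: real assume a: "a > 0"
    show "ennreal a * ennreal b \<le> \<Phi> t (ennreal a) + ?S"
    proof (rule ccontr)
      assume "\<not> ?thesis"
      then have *: "\<Phi> t (ennreal a) + ?S < ennreal a * ennreal b" by simp
      then have b: "b > 0" by (cases "b > 0") (auto simp: ennreal_neg)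
      obtain y where y: "\<Phi> t (ennreal a) + ?S = ennreal y" "y \<ge> 0"
        using * b a by (cases "\<Phi> t (ennreal a) + ?S") (auto simp flip: ennreal_mult)
      then have "y < a * b" using * a b by (simp add: ennreal_less_iff flip: ennreal_mult)
      then have "y / b < a" using b by (simp add: field_simps)
      then obtain q where q: "q \<in> \<rat>" "y / b < q" "q < a" using Rats_dense_in_real by blast
      then have q0: "q > 0" using y b by (smt (verit) divide_nonneg_pos)
      have "ennreal (q * b) - \<Phi> t (ennreal q) \<le> ?S" by (rule SUP_upper) (use q q0 in auto)
      then have "ennreal (q * b) \<le> \<Phi> t (ennreal q) + ?S" by (simp add: ennreal_minus_le_iff)
      also have "\<dots> \<le> \<Phi> t (ennreal a) + ?S"
        by (intro add_mono \<Phi>_mono order_refl ennreal_leI) (use q in auto)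
      finally have "q * b \<le> y" using y q0 b by simp
      then show False using q b by (simp add: field_simps)
    qed
  qed simp
  show "?S \<le> \<Psi> t (ennreal b)"
  proof (rule SUP_least)
    fix q :: real assume "q \<in> \<rat> \<inter> {0..}"
    then have "ennreal (q * b) = ennreal q * ennreal b"
      by (cases "b \<ge> 0") (auto simp: ennreal_mult ennreal_neg mult_nonneg_nonpos)
    then show "ennreal (q * b) - \<Phi> t (ennreal q) \<le> \<Psi> t (ennreal b)"
      using complementary_young[of q "ennreal b" \<Phi> t] by (auto simp: ennreal_minus_le_iff ennreal_mult_eq_top_iff)
  qed
qed

lemma \<Psi>_measurable [measurable (raw)]:
  assumes [measurable]: "x \<in> borel_measurable M"
  shows "(\<lambda>t. \<Psi> t (ennreal (x t))) \<in> borel_measurable M"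
proof -
  have "countable (\<rat> \<inter> {0::real..})" by (auto intro: countable_rat)
  then show ?thesis unfolding \<Psi>_conv_SUP by measurable
qed

text \<open>By monotonicity the points of finiteness form an interval starting at 0, and its
  rational points determine the right endpoint.\<close>

lemma finiteness_bound_conv_SUP:
  "finiteness_bound \<Psi> t = (SUP q\<in>\<rat>. if \<Psi> t (ennreal q) < \<infinity> then ennreal q else 0)" (is "_ = ?S")
proof (rule antisym)
  show "finiteness_bound \<Psi> t \<le> ?S"
    unfolding finiteness_bound_def
  proof (rule Sup_least)
    fix v assume "v \<in> {v. \<Psi> t v < \<infinity>}"
    then have v: "\<Psi> t v < \<infinity>" by simp
    show "v \<le> ?S"
    proof (rule dense_le)
      fix r assume r: "r < v"
      obtain y where y: "r < y" "y < v" using dense[OF r] by auto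
      obtain r' y' where r': "r = ennreal r'" "y = ennreal y'" "0 \<le> r'" "0 \<le> y'"
        using y by (cases r; cases y) (auto simp: less_top[symmetric] top_unique)
      with y have "r' < y'" by (simp add: ennreal_less_iff)
      then obtain q where q: "q \<in> \<rat>" "r' < q" "q < y'" using Rats_dense_in_real by blast
      have "ennreal q \<le> v" using q y r' by (metis ennreal_leI less_imp_le order_trans)
      then have "\<Psi> t (ennreal q) \<le> \<Psi> t v" by (rule complementary_mono)
      then have "\<Psi> t (ennreal q) < \<infinity>" using v by (rule le_less_trans)
      then show "r \<le> ?S" by (intro SUP_upper2[OF q(1)]) (use q r' in \<open>auto intro: ennreal_leI\<close>)
    qed
  qed
  show "?S \<le> finiteness_bound \<Psi> t"
    unfolding finiteness_bound_def by (rule SUP_least) (auto intro: Sup_upper)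
qed

lemma finiteness_bound_measurable [measurable]:
  "finiteness_bound \<Psi> \<in> borel_measurable M"
  unfolding finiteness_bound_conv_SUP[abs_def] using countable_rat by measurable

end

section \<open>The Orlicz space and its norm\<close>

lemma ennreal_le_divideI:
  assumes "ennreal k * a \<le> b" "k > 0"
  shows "a \<le> b / ennreal k"
proof -
  have "a = ennreal k * a / ennreal k"
    using assms(2) by (simp add: ennreal_divide_times mult.commute[of "ennreal k"] mult_divide_eq_ennreal)
  also have "\<dots> \<le> b / ennreal k" by (rule divide_right_mono_ennreal[OF assms(1)])
  finally show ?thesis .
qed

text \<open>Read \<open>(s, r)\<close> as constraint value and reward. Every slope from
  \<open>(1, H)\<close> to a point with \<open>s > 1\<close> is at most every slope to a point with
  \<open>s < 1\<close>, and a number separating the two families is a multiplier. The point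
  \<open>(0, 0)\<close>, strictly inside the constraint, keeps it finite. Convexity may lower
  \<open>s\<close>, as suits a convex constraint with a linear reward.\<close>

lemma ex_lagrange_multiplier:
  fixes P :: "(real \<times> real) set"
  assumes conv: "\<And>s1 r1 s2 r2 l. (s1, r1) \<in> P \<Longrightarrow> (s2, r2) \<in> P \<Longrightarrow> 0 \<le> l \<Longrightarrow> l \<le> 1 \<Longrightarrow>
      \<exists>s\<le>l * s1 + (1 - l) * s2. (s, l * r1 + (1 - l) * r2) \<in> P"
    and zero: "(0, 0) \<in> P"
    and bound: "\<And>s r. (s, r) \<in> P \<Longrightarrow> s \<le> 1 \<Longrightarrow> r \<le> H"
  shows "\<exists>c\<ge>0. \<forall>(s, r)\<in>P. r \<le> H + c * (s - 1)"
proof -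
  have H: "H \<ge> 0" using bound[OF zero] by simp
  have slope: "(r2 - H) * (1 - s1) \<le> (H - r1) * (s2 - 1)"
    if P: "(s1, r1) \<in> P" "(s2, r2) \<in> P" and s: "s1 < 1" "s2 > 1" for s1 r1 s2 r2
  proof -
    \<comment> \<open>The mixture of the two points whose constraint value is exactly 1.\<close>
    define l where "l = (s2 - 1) / (s2 - s1)"
    have l: "0 \<le> l" "l \<le> 1" using s by (auto simp: l_def)
    have l1: "l * (s2 - s1) = s2 - 1" "(1 - l) * (s2 - s1) = 1 - s1"
      using s by (auto simp: l_def divide_simps)
    have "l * s1 + (1 - l) * s2 = 1" using l1 by (simp add: algebra_simps)
    then have "l * r1 + (1 - l) * r2 \<le> H" using conv[OF P l] bound by auto
    then have "(1 - l) * (r2 - H) \<le> l * (H - r1)" by (simp add: algebra_simps)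
    then have "(1 - l) * (r2 - H) * (s2 - s1) \<le> l * (H - r1) * (s2 - s1)"
      using s by (intro mult_right_mono) auto
    then have "(r2 - H) * ((1 - l) * (s2 - s1)) \<le> (H - r1) * (l * (s2 - s1))"
      by (simp only: mult_ac)
    then show ?thesis unfolding l1 .
  qed
  \<comment> \<open>Inserting 0 makes the supremum nonnegative and covers the case that no point has
    \<open>s > 1\<close>.\<close>
  define A where "A = insert 0 {(r - H) / (s - 1) | s r. (s, r) \<in> P \<and> s > 1}"
  have A_le: "a \<le> (H - r1) / (1 - s1)" if "(s1, r1) \<in> P" "s1 < 1" "a \<in> A" for a s1 r1
    using that slope[OF that(1)] bound[OF that(1)] by (auto simp: A_def pos_le_divide_eq pos_divide_le_eq)
  have bdd: "bdd_above A" using A_le[OF zero] by (auto simp: bdd_above_def)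
  have "r \<le> H + Sup A * (s - 1)" if P: "(s, r) \<in> P" for s r
  proof -
    consider "s < 1" | "s = 1" | "s > 1" by linarith
    then show ?thesis
    proof cases
      case 1
      have "Sup A \<le> (H - r) / (1 - s)"
        by (rule cSup_least) (use A_le[OF P 1] in \<open>auto simp: A_def\<close>)
      then show ?thesis using 1 by (simp add: field_simps)
    next
      case 2
      then show ?thesis using bound[OF P] by simp
    next
      case 3
      have "(r - H) / (s - 1) \<le> Sup A" by (rule cSup_upper[OF _ bdd]) (use P 3 in \<open>auto simp: A_def\<close>)
      then show ?thesis using 3 by (simp add: field_simps)
    qed
  qed
  moreover have "0 \<le> Sup A" by (rule cSup_upper[OF _ bdd]) (auto simp: A_def)
  ultimately show ?thesis by auto
qed

context musielak_orlicz_space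
begin

abbreviation "L \<equiv> orlicz_space M \<Phi>"
abbreviation "I \<equiv> modular M \<Phi>"
abbreviation "J \<equiv> modular M \<Psi>"
abbreviation "N \<equiv> orlicz_norm M \<Phi>"

lemma modular_mono:
  assumes "AE t in M. \<bar>x t\<bar> \<le> \<bar>y t\<bar>"
  shows "I x \<le> I y"
  unfolding modular_def
  by (rule nn_integral_mono_AE) (use assms in \<open>auto elim!: eventually_mono intro!: \<Phi>_mono ennreal_leI\<close>)

lemma modular_convex:
  assumes [measurable]: "x \<in> borel_measurable M" "y \<in> borel_measurable M" and l: "0 \<le> l" "l \<le> (1::real)"
  shows "I (\<lambda>t. l * x t + (1 - l) * y t) \<le> ennreal l * I x + ennreal (1 - l) * I y"
proof -
  have "I (\<lambda>t. l * x t + (1 - l) * y t)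
      \<le> (\<integral>\<^sup>+ t. ennreal l * \<Phi> t (ennreal \<bar>x t\<bar>) + ennreal (1 - l) * \<Phi> t (ennreal \<bar>y t\<bar>) \<partial>M)"
    unfolding modular_def
  proof (rule nn_integral_mono)
    fix t
    have "\<bar>l * x t + (1 - l) * y t\<bar> \<le> l * \<bar>x t\<bar> + (1 - l) * \<bar>y t\<bar>"
      using l abs_triangle_ineq[of "l * x t" "(1 - l) * y t"] by (simp add: abs_mult)
    then have "\<Phi> t (ennreal \<bar>l * x t + (1 - l) * y t\<bar>) \<le> \<Phi> t (ennreal l * ennreal \<bar>x t\<bar> + ennreal (1 - l) * ennreal \<bar>y t\<bar>)"
      using l by (intro \<Phi>_mono) (simp add: ennreal_leI flip: ennreal_mult ennreal_plus)
    also have "\<dots> \<le> ennreal l * \<Phi> t (ennreal \<bar>x t\<bar>) + ennreal (1 - l) * \<Phi> t (ennreal \<bar>y t\<bar>)"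
      by (rule \<Phi>_convex[OF l])
    finally show "\<Phi> t (ennreal \<bar>l * x t + (1 - l) * y t\<bar>) \<le> \<dots>" .
  qed
  also have "\<dots> = ennreal l * I x + ennreal (1 - l) * I y"
    unfolding modular_def by (simp add: nn_integral_add nn_integral_cmult)
  finally show ?thesis .
qed

lemma complementary_modular_convex:
  assumes [measurable]: "x \<in> borel_measurable M" "y \<in> borel_measurable M" and l: "0 \<le> l" "l \<le> (1::real)"
  shows "J (\<lambda>t. l * x t + (1 - l) * y t) \<le> ennreal l * J x + ennreal (1 - l) * J y"
proof -
  have "J (\<lambda>t. l * x t + (1 - l) * y t)
      \<le> (\<integral>\<^sup>+ t. ennreal l * \<Psi> t (ennreal \<bar>x t\<bar>) + ennreal (1 - l) * \<Psi> t (ennreal \<bar>y t\<bar>) \<partial>M)"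
    unfolding modular_def
  proof (rule nn_integral_mono)
    fix t
    have "\<bar>l * x t + (1 - l) * y t\<bar> \<le> l * \<bar>x t\<bar> + (1 - l) * \<bar>y t\<bar>"
      using l abs_triangle_ineq[of "l * x t" "(1 - l) * y t"] by (simp add: abs_mult)
    then have "\<Psi> t (ennreal \<bar>l * x t + (1 - l) * y t\<bar>) \<le> \<Psi> t (ennreal l * ennreal \<bar>x t\<bar> + ennreal (1 - l) * ennreal \<bar>y t\<bar>)"
      using l by (intro complementary_mono) (simp add: ennreal_leI flip: ennreal_mult ennreal_plus)
    also have "\<dots> \<le> ennreal l * \<Psi> t (ennreal \<bar>x t\<bar>) + ennreal (1 - l) * \<Psi> t (ennreal \<bar>y t\<bar>)"
      by (rule complementary_convex[OF l]) auto
    finally show "\<Psi> t (ennreal \<bar>l * x t + (1 - l) * y t\<bar>) \<le> \<dots>" .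
  qed
  also have "\<dots> = ennreal l * J x + ennreal (1 - l) * J y"
    unfolding modular_def by (simp add: nn_integral_add nn_integral_cmult)
  finally show ?thesis .
qed

lemma L_measurable: "x \<in> L \<Longrightarrow> x \<in> borel_measurable M"
  by (simp add: orlicz_space_def)

lemma L_obtain:
  assumes "x \<in> L"
  obtains c where "c > 0" "I (\<lambda>t. c * x t) < \<infinity>"
  using assms by (auto simp: orlicz_space_def)

lemma L_if_modular_finite:
  assumes "x \<in> borel_measurable M" "I x < \<infinity>"
  shows "x \<in> L"
  unfolding orlicz_space_def using assms by (auto intro!: exI[of _ 1])

lemma L_dominated:
  assumes "x \<in> borel_measurable M" "y \<in> L" "AE t in M. \<bar>x t\<bar> \<le> \<bar>y t\<bar>"
  shows "x \<in> L"
proof -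
  obtain c where c: "c > 0" "I (\<lambda>t. c * y t) < \<infinity>" using L_obtain[OF assms(2)] .
  have "I (\<lambda>t. c * x t) \<le> I (\<lambda>t. c * y t)"
    by (rule modular_mono) (use assms(3) c(1) in \<open>auto elim!: eventually_mono simp: abs_mult\<close>)
  then show ?thesis using c assms(1) by (auto simp: orlicz_space_def intro!: exI[of _ c] intro: le_less_trans)
qed

lemma L_cmult:
  assumes "x \<in> L"
  shows "(\<lambda>t. a * x t) \<in> L"
proof (cases "a = 0")
  case True
  then show ?thesis by (auto intro!: L_if_modular_finite simp: modular_def)
next
  case False
  obtain c where c: "c > 0" "I (\<lambda>t. c * x t) < \<infinity>" using L_obtain[OF assms] .
  have "I (\<lambda>t. c / \<bar>a\<bar> * (a * x t)) = I (\<lambda>t. c * x t)"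
    using False c(1) by (simp add: modular_def abs_mult)
  then show ?thesis
    using c False L_measurable[OF assms] by (auto simp: orlicz_space_def intro!: exI[of _ "c / \<bar>a\<bar>"])
qed

lemma L_zero [simp]: "(\<lambda>t. 0) \<in> L"
  by (auto intro!: L_if_modular_finite simp: modular_def)

lemma L_uminus: "x \<in> L \<Longrightarrow> (\<lambda>t. - x t) \<in> L"
  using L_cmult[of x "-1"] by simp

lemma L_abs: "x \<in> L \<Longrightarrow> (\<lambda>t. \<bar>x t\<bar>) \<in> L"
  by (rule L_dominated[of _ x]) (auto intro: L_measurable borel_measurable_abs)

lemma L_add:
  assumes "x \<in> L" "y \<in> L"
  shows "(\<lambda>t. x t + y t) \<in> L"
proof -
  note [measurable] = assms[THEN L_measurable]
  obtain c where c: "c > 0" "I (\<lambda>t. c * x t) < \<infinity>" using L_obtain[OF assms(1)] .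
  obtain d where d: "d > 0" "I (\<lambda>t. d * y t) < \<infinity>" using L_obtain[OF assms(2)] .
  define m where "m = min c d"
  have m: "m > 0" "I (\<lambda>t. m * x t) < \<infinity>" "I (\<lambda>t. m * y t) < \<infinity>"
    using c d modular_mono[of "\<lambda>t. m * x t" "\<lambda>t. c * x t"] modular_mono[of "\<lambda>t. m * y t" "\<lambda>t. d * y t"]
    by (auto simp: m_def abs_mult mult_right_mono intro: le_less_trans)
  have "I (\<lambda>t. m / 2 * (x t + y t)) = I (\<lambda>t. (1/2) * (m * x t) + (1 - 1/2) * (m * y t))"
  proof -
    have "m / 2 * (x t + y t) = (1/2) * (m * x t) + (1 - 1/2) * (m * y t)" for t by (simp add: algebra_simps)
    then show ?thesis by (simp only:)
  qed
  also have "\<dots> \<le> ennreal (1/2) * I (\<lambda>t. m * x t) + ennreal (1 - 1/2) * I (\<lambda>t. m * y t)"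
    by (rule modular_convex) auto
  also have "\<dots> < \<infinity>"
  proof -
    have "ennreal a * b < top" if "b < top" for a b
      using that ennreal_less_top[of a] unfolding ennreal_mult_less_top by blast
    then show ?thesis using m by (simp only: ennreal_add_less_top infinity_ennreal_def simp_thms)
  qed
  finally show ?thesis
    using m by (auto simp: orlicz_space_def intro!: exI[of _ "m / 2"])
qed

lemma L_diff:
  assumes "x \<in> L" "y \<in> L"
  shows "(\<lambda>t. x t - y t) \<in> L"
  using L_add[OF assms(1) L_uminus[OF assms(2)]] by simp

lemma L_min:
  assumes "x \<in> L" "y \<in> L"
  shows "(\<lambda>t. min (x t) (y t)) \<in> L"
  by (rule L_dominated[OF _ L_add[OF assms[THEN L_abs]]])
    (use assms[THEN L_measurable] in auto)

lemma L_max: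
  assumes "x \<in> L" "y \<in> L"
  shows "(\<lambda>t. max (x t) (y t)) \<in> L"
  by (rule L_dominated[OF _ L_add[OF assms[THEN L_abs]]])
    (use assms[THEN L_measurable] in auto)

lemma L_indicator:
  assumes "x \<in> L" "E \<in> sets M"
  shows "(\<lambda>t. x t * indicator E t) \<in> L"
  by (rule L_dominated[OF _ assms(1)])
    (use assms L_measurable[OF assms(1)] in \<open>auto simp: indicator_def\<close>)

lemma nn_integral_young:
  assumes [measurable]: "x \<in> borel_measurable M" "y \<in> borel_measurable M"
  shows "(\<integral>\<^sup>+ t. ennreal (\<bar>x t\<bar> * \<bar>y t\<bar>) \<partial>M) \<le> I x + J y"
proof -
  have "(\<integral>\<^sup>+ t. ennreal (\<bar>x t\<bar> * \<bar>y t\<bar>) \<partial>M)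
      \<le> (\<integral>\<^sup>+ t. \<Phi> t (ennreal \<bar>x t\<bar>) + \<Psi> t (ennreal \<bar>y t\<bar>) \<partial>M)"
    by (intro nn_integral_mono) (simp add: complementary_young ennreal_mult)
  also have "\<dots> = I x + J y" unfolding modular_def by (simp add: nn_integral_add)
  finally show ?thesis .
qed

lemma nn_integral_product_finite:
  assumes "x \<in> L" "y \<in> orlicz_space M \<Psi>"
  shows "(\<integral>\<^sup>+ t. ennreal (\<bar>x t\<bar> * \<bar>y t\<bar>) \<partial>M) < \<infinity>"
proof -
  obtain c where c: "c > 0" "I (\<lambda>t. c * x t) < \<infinity>" using L_obtain[OF assms(1)] .
  obtain d where d: "d > 0" "J (\<lambda>t. d * y t) < \<infinity>" and [measurable]: "y \<in> borel_measurable M"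
    using assms(2) by (auto simp: orlicz_space_def)
  note [measurable] = L_measurable[OF assms(1)]
  have "ennreal (c * d) * (\<integral>\<^sup>+ t. ennreal (\<bar>x t\<bar> * \<bar>y t\<bar>) \<partial>M)
      = (\<integral>\<^sup>+ t. ennreal (\<bar>c * x t\<bar> * \<bar>d * y t\<bar>) \<partial>M)"
    using c(1) d(1)
    by (subst nn_integral_cmult[symmetric]) (auto simp: abs_mult mult_ac simp flip: ennreal_mult' intro!: nn_integral_cong)
  also have "\<dots> \<le> I (\<lambda>t. c * x t) + J (\<lambda>t. d * y t)" by (rule nn_integral_young) auto
  also have "\<dots> < \<infinity>" using c d by simp
  finally show ?thesis using c(1) d(1) by (auto simp: ennreal_mult_less_top)
qed

lemma integrable_product:
  assumes "x \<in> L" "y \<in> orlicz_space M \<Psi>"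
  shows "integrable M (\<lambda>t. x t * y t)"
proof (rule integrableI_bounded)
  show "(\<lambda>t. x t * y t) \<in> borel_measurable M" using assms by (auto simp: orlicz_space_def)
  show "(\<integral>\<^sup>+ t. ennreal (norm (x t * y t)) \<partial>M) < \<infinity>"
    using nn_integral_product_finite[OF assms] by (simp add: abs_mult)
qed

text \<open>Integrability is not assumed: otherwise the left side is 0 by convention.\<close>

lemma abs_integral_le_nn_integral:
  fixes g :: "'a \<Rightarrow> real"
  shows "ennreal \<bar>\<integral>t. g t \<partial>M\<bar> \<le> (\<integral>\<^sup>+ t. ennreal \<bar>g t\<bar> \<partial>M)"
  using integral_norm_bound_ennreal[of M g] by (cases "integrable M g") (auto simp: not_integrable_integral_eq)

text \<open>The easy half of the duality: Young's inequality for \<open>k * w\<close> and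
  \<open>v\<close>, divided by \<open>k\<close>.\<close>

lemma abs_integral_le_amemiya:
  assumes "w \<in> L" "v \<in> borel_measurable M" "J v \<le> 1" "k > 0"
  shows "ennreal \<bar>\<integral>t. w t * v t \<partial>M\<bar> \<le> amemiya M \<Phi> w k"
proof -
  note [measurable] = L_measurable[OF assms(1)] assms(2)
  have "ennreal k * ennreal \<bar>\<integral>t. w t * v t \<partial>M\<bar> = ennreal \<bar>\<integral>t. k * w t * v t \<partial>M\<bar>"
    using assms(4) by (simp add: abs_mult mult.assoc flip: ennreal_mult)
  also have "\<dots> \<le> (\<integral>\<^sup>+ t. ennreal (\<bar>k * w t\<bar> * \<bar>v t\<bar>) \<partial>M)"
    using abs_integral_le_nn_integral[of "\<lambda>t. k * w t * v t"] by (simp add: abs_mult)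
  also have "\<dots> \<le> I (\<lambda>t. k * w t) + J v" by (rule nn_integral_young) auto
  also have "\<dots> \<le> 1 + I (\<lambda>t. k * w t)" using assms(3) by (simp add: add.commute add_mono)
  finally show ?thesis
    unfolding amemiya_def using assms(4) ennreal_le_divideI by blast
qed

lemma amemiya_finite:
  assumes "w \<in> L"
  obtains k where "k > 0" "amemiya M \<Phi> w k < \<infinity>"
proof -
  obtain k where "k > 0" "I (\<lambda>t. k * w t) < \<infinity>" using L_obtain[OF assms] .
  then show ?thesis using that[of k] by (auto simp: amemiya_def ennreal_divide_eq_top_iff less_top[symmetric])
qed

lemma bdd_above_orlicz_norm:
  assumes "w \<in> L"
  shows "bdd_above ((\<lambda>v. \<bar>\<integral>t. w t * v t \<partial>M\<bar>) ` {v \<in> orlicz_class M \<Psi>. J v \<le> 1})"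
proof -
  obtain k where k: "k > 0" "amemiya M \<Phi> w k < \<infinity>" using amemiya_finite[OF assms] .
  then obtain a where a: "amemiya M \<Phi> w k = ennreal a" "a \<ge> 0" by (cases "amemiya M \<Phi> w k") auto
  have "\<bar>\<integral>t. w t * v t \<partial>M\<bar> \<le> a" if "v \<in> orlicz_class M \<Psi>" "J v \<le> 1" for v
    using abs_integral_le_amemiya[OF assms _ that(2) k(1)] that a by (auto simp: orlicz_class_def)
  then show ?thesis by (auto simp: bdd_above_def)
qed

lemma abs_integral_le_norm:
  assumes "w \<in> L" "v \<in> borel_measurable M" "J v \<le> 1"
  shows "\<bar>\<integral>t. w t * v t \<partial>M\<bar> \<le> N w"
  unfolding orlicz_norm_def
  by (rule cSUP_upper[OF _ bdd_above_orlicz_norm[OF assms(1)]])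
    (use assms in \<open>auto simp: orlicz_class_def intro: le_less_trans\<close>)

lemma norm_nonneg: "w \<in> L \<Longrightarrow> 0 \<le> N w"
  using abs_integral_le_norm[of w "\<lambda>t. 0"] by (simp add: modular_def)

lemma norm_le_if:
  assumes "w \<in> L" "\<And>v. v \<in> borel_measurable M \<Longrightarrow> J v \<le> 1 \<Longrightarrow> ennreal \<bar>\<integral>t. w t * v t \<partial>M\<bar> \<le> c"
  shows "ennreal (N w) \<le> c"
proof (cases c)
  case (real r)
  have "N w \<le> r"
    unfolding orlicz_norm_def
  proof (rule cSUP_least)
    have "(\<lambda>t. 0) \<in> {v \<in> orlicz_class M \<Psi>. J v \<le> 1}" by (simp add: orlicz_class_def modular_def)
    then show "{v \<in> orlicz_class M \<Psi>. J v \<le> 1} \<noteq> {}" by blast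
  qed (use assms(2) real in \<open>auto simp: orlicz_class_def\<close>)
  then show ?thesis using real by (simp add: ennreal_leI)
qed simp

lemma norm_le_amemiya:
  assumes "w \<in> L" "k > 0"
  shows "ennreal (N w) \<le> amemiya M \<Phi> w k"
  by (rule norm_le_if[OF assms(1) abs_integral_le_amemiya[OF assms(1) _ _ assms(2)]])

text \<open>Giving \<open>|v|\<close> the sign of \<open>w\<close> does not increase
  \<open>J\<close> and turns the pairing into the integral of \<open>|w| |v|\<close>.\<close>

lemma nn_integral_le_norm:
  assumes "w \<in> L" "v \<in> borel_measurable M" "J v \<le> 1"
  shows "(\<integral>\<^sup>+ t. ennreal (\<bar>w t\<bar> * \<bar>v t\<bar>) \<partial>M) \<le> ennreal (N w)"
proof -
  note [measurable] = assms(2) L_measurable[OF assms(1)]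
  define v' where "v' t = sgn (w t) * \<bar>v t\<bar>" for t
  have [measurable]: "v' \<in> borel_measurable M" unfolding v'_def by measurable
  have "J v' \<le> J v"
    unfolding modular_def
    by (intro nn_integral_mono complementary_mono ennreal_leI) (auto simp: v'_def abs_mult sgn_if)
  then have J: "J v' \<le> 1" using assms(3) by simp
  have "v' \<in> orlicz_space M \<Psi>" using J by (auto simp: orlicz_space_def intro!: exI[of _ 1] intro: le_less_trans)
  then have int: "integrable M (\<lambda>t. w t * v' t)" by (rule integrable_product[OF assms(1)])
  have eq: "w t * v' t = \<bar>w t\<bar> * \<bar>v t\<bar>" for t by (auto simp: v'_def sgn_if)
  have "(\<integral>\<^sup>+ t. ennreal (\<bar>w t\<bar> * \<bar>v t\<bar>) \<partial>M) = ennreal (\<integral>t. w t * v' t \<partial>M)"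
    using nn_integral_eq_integral[OF int] by (simp add: eq)
  also have "\<dots> \<le> ennreal (N w)"
    using abs_integral_le_norm[OF assms(1) _ J] by (intro ennreal_leI) auto
  finally show ?thesis .
qed

end

section \<open>The Orlicz norm is the Amemiya norm\<close>

context musielak_orlicz_space
begin

text \<open>The hard half of the duality. Maximize the reward \<open>R v\<close> under the
  constraint \<open>J v <= 1\<close>. With a multiplier the constraint disappears, the maximization
  becomes pointwise, and its value is a modular of \<open>w / c\<close>.\<close>

lemma ex_amemiya_le:
  assumes w: "w \<in> L" and e: "e > 0"
  shows "\<exists>k>0. amemiya M \<Phi> w k \<le> ennreal (N w + e)"
proof -
  note [measurable] = L_measurable[OF w]
  define V where "V = {v \<in> borel_measurable M. (\<forall>t. 0 \<le> v t) \<and> J v < \<infinity>}"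
  define R where "R v = (\<integral>\<^sup>+ t. ennreal (\<bar>w t\<bar> * v t) \<partial>M)" for v
  have V_meas: "v \<in> borel_measurable M" if "v \<in> V" for v using that by (simp add: V_def)
  have R_fin: "R v < \<infinity>" if v: "v \<in> V" for v
  proof -
    have "v \<in> orlicz_space M \<Psi>"
      using v by (auto simp: V_def orlicz_space_def intro!: exI[of _ 1])
    from nn_integral_product_finite[OF w this] v show ?thesis by (simp add: R_def V_def)
  qed
  have R_le: "enn2real (R v) \<le> N w" if v: "v \<in> V" "J v \<le> 1" for v
  proof -
    have "R v \<le> ennreal (N w)" using nn_integral_le_norm[OF w _ v(2)] v(1) by (simp add: R_def V_def)
    then show ?thesis using norm_nonneg[OF w] by (simp add: enn2real_leI)
  qed
  define P where "P = (\<lambda>v. (enn2real (J v), enn2real (R v))) ` V"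
  have "\<exists>c\<ge>0. \<forall>(s, r)\<in>P. r \<le> N w + c * (s - 1)"
  proof (rule ex_lagrange_multiplier)
    fix s1 r1 s2 r2 l :: real
    assume "(s1, r1) \<in> P" "(s2, r2) \<in> P" and l: "0 \<le> l" "l \<le> 1"
    then obtain v1 v2 where v: "v1 \<in> V" "v2 \<in> V" "s1 = enn2real (J v1)" "s2 = enn2real (J v2)"
      "r1 = enn2real (R v1)" "r2 = enn2real (R v2)" by (auto simp: P_def)
    note [measurable] = v(1,2)[THEN V_meas]
    define v where "v t = l * v1 t + (1 - l) * v2 t" for t
    have fin: "J v1 < top" "J v2 < top" using v by (auto simp: V_def)
    have J: "J v \<le> ennreal l * J v1 + ennreal (1 - l) * J v2"
      unfolding v_def by (rule complementary_modular_convex) (use l in auto)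
    also have "\<dots> = ennreal (l * s1 + (1 - l) * s2)"
      using fin l by (simp add: v(3,4) ennreal_mult less_top)
    finally have J': "J v \<le> ennreal (l * s1 + (1 - l) * s2)" .
    have vV: "v \<in> V"
      using v l le_less_trans[OF J' ennreal_less_top] unfolding V_def by (auto simp: v_def[abs_def])
    have "enn2real (J v) \<le> l * s1 + (1 - l) * s2"
      using J' l v(3,4) by (intro enn2real_leI) auto
    moreover have "enn2real (R v) = l * r1 + (1 - l) * r2"
    proof -
      have "R v = (\<integral>\<^sup>+ t. ennreal l * ennreal (\<bar>w t\<bar> * v1 t) + ennreal (1 - l) * ennreal (\<bar>w t\<bar> * v2 t) \<partial>M)"
        unfolding R_def
      proof (rule nn_integral_cong)
        fix t
        have "\<bar>w t\<bar> * v t = l * (\<bar>w t\<bar> * v1 t) + (1 - l) * (\<bar>w t\<bar> * v2 t)"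
          by (simp add: v_def algebra_simps)
        moreover have "0 \<le> \<bar>w t\<bar> * v1 t" "0 \<le> \<bar>w t\<bar> * v2 t" using v(1,2) by (auto simp: V_def)
        ultimately show "ennreal (\<bar>w t\<bar> * v t) =
            ennreal l * ennreal (\<bar>w t\<bar> * v1 t) + ennreal (1 - l) * ennreal (\<bar>w t\<bar> * v2 t)"
          using l by (simp flip: ennreal_mult ennreal_plus)
      qed
      also have "\<dots> = ennreal l * R v1 + ennreal (1 - l) * R v2"
        unfolding R_def by (simp add: nn_integral_add nn_integral_cmult)
      also have "\<dots> = ennreal (l * r1 + (1 - l) * r2)"
        using R_fin[OF v(1)] R_fin[OF v(2)] l by (simp add: v(5,6) ennreal_mult less_top)
      finally have Rv: "R v = ennreal (l * r1 + (1 - l) * r2)" .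
      show ?thesis unfolding Rv by (rule enn2real_ennreal) (use l in \<open>simp add: v(5,6)\<close>)
    qed
    ultimately show "\<exists>s\<le>l * s1 + (1 - l) * s2. (s, l * r1 + (1 - l) * r2) \<in> P"
      unfolding P_def using vV by (intro exI[of _ "enn2real (J v)"] conjI image_eqI[of _ _ v]) auto
  next
    show "(0, 0) \<in> P"
      unfolding P_def by (intro image_eqI[of _ _ "\<lambda>t. 0"]) (auto simp: V_def R_def modular_def)
  next
    fix s r :: real assume "(s, r) \<in> P" "s \<le> 1"
    then obtain v where v: "v \<in> V" "s = enn2real (J v)" "r = enn2real (R v)" by (auto simp: P_def)
    have "J v = ennreal s" using v by (simp add: V_def less_top)
    then have "J v \<le> 1" using \<open>s \<le> 1\<close> by (simp add: ennreal_le_1)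
    with R_le v show "r \<le> N w" by simp
  qed
  then obtain c0 where c0: "c0 \<ge> 0" "\<And>v. v \<in> V \<Longrightarrow> enn2real (R v) \<le> N w + c0 * (enn2real (J v) - 1)"
    by (auto simp: P_def)
  \<comment> \<open>Testing with \<open>v = 0\<close>; this makes \<open>r\<close> below
    nonnegative.\<close>
  have "c0 \<le> N w" using c0(2)[of "\<lambda>t. 0"] by (simp add: V_def R_def modular_def)
  \<comment> \<open>The multiplier \<open>c0\<close> may be 0, but \<open>k = 1 / c\<close> needs
    \<open>c > 0\<close>; this is where the slack \<open>e\<close> is spent.\<close>
  define c where "c = c0 + e"
  have c: "c > 0" "c \<le> N w + e" using c0 e \<open>c0 \<le> N w\<close> by (auto simp: c_def)
  \<comment> \<open>Thus \<open>r = N w - c0\<close>, and the bound on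
    \<open>c + c * I (w / c)\<close> by \<open>N w + e\<close> becomes a bound on
    \<open>c * I (w / c)\<close> by \<open>r\<close>.\<close>
  define r where "r = N w + e - c"
  have r: "r \<ge> 0" using c by (simp add: r_def)
  have "ennreal c * I (\<lambda>t. (1 / c) * w t) \<le> ennreal r"
  proof (rule ccontr)
    assume "\<not> ?thesis"
    then have "ennreal r < ennreal c * I (\<lambda>t. (1 / c) * w t)" by simp
    also have "\<dots> = (\<integral>\<^sup>+ t. ennreal c * \<Phi> t (ennreal (\<bar>w t\<bar> / c)) \<partial>M)"
      unfolding modular_def using c by (simp add: nn_integral_cmult abs_mult)
    \<comment> \<open>Pointwise biconjugation, scaled by \<open>c\<close>: each value below the left
      integrand is reached by a rational \<open>q\<close>.\<close>
    also have "\<dots> \<le> (\<integral>\<^sup>+ t. (SUP q\<in>\<rat> \<inter> {0..}. ennreal (\<bar>w t\<bar> * q) - ennreal c * \<Psi> t (ennreal q)) \<partial>M)"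
    proof (rule nn_integral_mono, rule dense_le)
      fix t y assume y: "y < ennreal c * \<Phi> t (ennreal (\<bar>w t\<bar> / c))"
      obtain y' where y': "y = ennreal y'" "y' \<ge> 0" using y by (cases y) (auto simp: top_unique)
      have "ennreal (y' / c) < \<Phi> t (ennreal (\<bar>w t\<bar> / c))"
      proof -
        have "y / ennreal c < \<Phi> t (ennreal (\<bar>w t\<bar> / c))"
          using y c by (subst divide_less_ennreal) (auto simp: mult.commute)
        then show ?thesis using y' c by (simp add: divide_ennreal)
      qed
      from young_function.fenchel_moreau[OF young this, of t] y' c
      obtain q where q: "q \<in> \<rat>" "q \<ge> 0"
        "ennreal (y' / c) + complementary (\<lambda>_. \<Phi> t) t (ennreal q) < ennreal (\<bar>w t\<bar> / c * q)"
        by auto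
      have eq: "complementary (\<lambda>_. \<Phi> t) t = \<Psi> t" by (simp add: complementary_def fun_eq_iff)
      have "y + ennreal c * \<Psi> t (ennreal q) = ennreal c * (ennreal (y' / c) + \<Psi> t (ennreal q))"
        using c y' by (simp add: distrib_left flip: ennreal_mult)
      also have "\<dots> \<le> ennreal c * ennreal (\<bar>w t\<bar> / c * q)"
        using q(3) unfolding eq by (intro mult_left_mono) auto
      also have "\<dots> = ennreal (\<bar>w t\<bar> * q)" using c q(2) by (simp flip: ennreal_mult)
      finally have le: "y + ennreal c * \<Psi> t (ennreal q) \<le> ennreal (\<bar>w t\<bar> * q)" .
      have "ennreal c * \<Psi> t (ennreal q) \<noteq> top"
        using le by (auto simp: top_unique)
      then have "y = y + ennreal c * \<Psi> t (ennreal q) - ennreal c * \<Psi> t (ennreal q)" by simp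
      also have "\<dots> \<le> ennreal (\<bar>w t\<bar> * q) - ennreal c * \<Psi> t (ennreal q)"
        by (intro ennreal_minus_mono le) auto
      also have "\<dots> \<le> (SUP q\<in>\<rat> \<inter> {0..}. ennreal (\<bar>w t\<bar> * q) - ennreal c * \<Psi> t (ennreal q))"
        by (rule SUP_upper) (use q in auto)
      finally show "y \<le> \<dots>" .
    qed
    finally obtain x where x: "x \<in> borel_measurable M" "\<And>t. 0 \<le> x t"
      "(\<integral>\<^sup>+ t. ennreal c * \<Psi> t (ennreal (x t)) \<partial>M) < \<infinity>"
      "ennreal r + (\<integral>\<^sup>+ t. ennreal c * \<Psi> t (ennreal (x t)) \<partial>M) < (\<integral>\<^sup>+ t. ennreal (\<bar>w t\<bar> * x t) \<partial>M)"
      by (rule ex_measurable_selection[rotated 3]) auto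
    note [measurable] = x(1)
    have eq: "(\<integral>\<^sup>+ t. ennreal c * \<Psi> t (ennreal (x t)) \<partial>M) = ennreal c * J x"
      unfolding modular_def using x(2) by (simp add: nn_integral_cmult)
    have Jx: "J x < \<infinity>" using x(3) c unfolding eq by (auto simp: ennreal_mult_less_top)
    have xV: "x \<in> V" using x(1,2) Jx by (simp add: V_def)
    obtain s where s: "J x = ennreal s" "s \<ge> 0" using Jx by (cases "J x") auto
    obtain p where p: "R x = ennreal p" "p \<ge> 0" using R_fin[OF xV] by (cases "R x") auto
    \<comment> \<open>The selected \<open>x\<close> violates the multiplier inequality: inserting
      \<open>r\<close> and \<open>c\<close> into this and the next line leaves
      \<open>e * s < 0\<close>.\<close>
    have "r + c * s < p"
      using x(4) unfolding eq R_def[symmetric] s p using r s p c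
      by (simp add: ennreal_less_iff flip: ennreal_mult ennreal_plus)
    moreover have "p \<le> N w + c0 * (s - 1)" using c0(2)[OF xV] s p by simp
    moreover have "e * s \<ge> 0" using e s by simp
    ultimately show False by (simp add: r_def c_def algebra_simps)
  qed
  then have *: "ennreal c + ennreal c * I (\<lambda>t. (1 / c) * w t) \<le> ennreal (N w + e)"
    using add_left_mono[of _ "ennreal r" "ennreal c"] r c by (simp add: r_def flip: ennreal_plus)
  have "amemiya M \<Phi> w (1 / c) = ennreal c * (1 + I (\<lambda>t. (1 / c) * w t))"
  proof -
    have "z / ennreal (1 / c) = ennreal c * z" for z
    proof -
      have "z = z * ennreal c * ennreal (1 / c)" using c by (simp add: mult.assoc flip: ennreal_mult)
      then have "z / ennreal (1 / c) = z * ennreal c * ennreal (1 / c) / ennreal (1 / c)" by simp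
      also have "\<dots> = z * ennreal c" using c by (intro mult_divide_eq_ennreal) auto
      finally show ?thesis by (simp add: mult.commute)
    qed
    then show ?thesis unfolding amemiya_def .
  qed
  also have "\<dots> \<le> ennreal (N w + e)" using * by (simp add: distrib_left)
  finally show ?thesis using c by (intro exI[of _ "1 / c"]) auto
qed

theorem orlicz_norm_eq_amemiya:
  assumes "w \<in> L"
  shows "ennreal (N w) = (INF k\<in>{0<..}. amemiya M \<Phi> w k)"
proof (rule antisym)
  show "ennreal (N w) \<le> (INF k\<in>{0<..}. amemiya M \<Phi> w k)"
    by (rule INF_greatest) (use norm_le_amemiya[OF assms] in auto)
  show "(INF k\<in>{0<..}. amemiya M \<Phi> w k) \<le> ennreal (N w)"
  proof (rule ennreal_le_epsilon)
    fix e :: real assume "0 < e"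
    then obtain k where k: "k > 0" "amemiya M \<Phi> w k \<le> ennreal (N w + e)"
      using ex_amemiya_le[OF assms] by blast
    have "(INF k\<in>{0<..}. amemiya M \<Phi> w k) \<le> amemiya M \<Phi> w k" by (rule INF_lower) (use k in auto)
    also note k(2)
    finally show "(INF k\<in>{0<..}. amemiya M \<Phi> w k) \<le> ennreal (N w) + ennreal e"
      using norm_nonneg[OF assms] \<open>0 < e\<close> by (simp add: ennreal_plus)
  qed
qed

section \<open>Monotonicity and definiteness of the norm\<close>

lemma amemiya_mono:
  assumes "AE t in M. \<bar>x t\<bar> \<le> \<bar>y t\<bar>"
  shows "amemiya M \<Phi> x k \<le> amemiya M \<Phi> y k"
  unfolding amemiya_def
  by (intro divide_right_mono_ennreal add_mono order_refl modular_mono)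
    (use assms in \<open>auto elim!: eventually_mono simp: abs_mult intro: mult_left_mono\<close>)

lemma norm_mono:
  assumes "x \<in> L" "y \<in> L" "AE t in M. \<bar>x t\<bar> \<le> \<bar>y t\<bar>"
  shows "N x \<le> N y"
proof -
  have "ennreal (N x) \<le> ennreal (N y)"
    unfolding orlicz_norm_eq_amemiya[OF assms(1)] orlicz_norm_eq_amemiya[OF assms(2)]
    by (intro INF_mono') (rule amemiya_mono[OF assms(3)])
  then show ?thesis using norm_nonneg[OF assms(2)] by simp
qed

lemma norm_eq_0:
  assumes "x \<in> L" "AE t in M. x t = 0"
  shows "N x = 0"
proof -
  have "ennreal (N x) \<le> 0"
  proof (rule norm_le_if[OF assms(1)])
    fix v :: "'a \<Rightarrow> real"
    have "(\<integral>t. x t * v t \<partial>M) = 0"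
      by (rule integral_eq_zero_AE) (use assms(2) in \<open>auto elim!: eventually_mono\<close>)
    then show "ennreal \<bar>\<integral>t. x t * v t \<partial>M\<bar> \<le> 0" by simp
  qed
  then show ?thesis using norm_nonneg[OF assms(1)] by (simp add: ennreal_eq_0_iff)
qed

text \<open>A small Amemiya value forces a large \<open>k\<close>, since \<open>1 / k\<close> is one
  of its summands. Convexity then shrinks \<open>I (k x)\<close> to an arbitrarily small bound for
  \<open>I (n x)\<close>, for every \<open>n\<close>, whereas \<Phi> is positive at large
  arguments.\<close>

lemma norm_pos:
  assumes x: "x \<in> L" and nz: "\<not> (AE t in M. x t = 0)"
  shows "0 < N x"
proof (rule ccontr)
  assume "\<not> ?thesis"
  then have 0: "N x = 0" using norm_nonneg[OF x] by simp
  note [measurable] = L_measurable[OF x]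
  have "I (\<lambda>t. real n * x t) \<le> ennreal e" if e: "e > 0" for n e
  proof -
    \<comment> \<open>Small enough that \<open>d * n <= e\<close>, the final bound, and
      \<open>d * n <= 1\<close>, which makes \<open>n / k\<close> a convex weight.\<close>
    define d where "d = min e 1 / (real n + 1)"
    have d: "d > 0" "d * real n \<le> e" "d * real n \<le> 1"
    proof -
      have "min e 1 * real n \<le> e * (real n + 1)" "min e 1 * real n \<le> 1 * (real n + 1)"
        using e by (intro mult_mono; simp)+
      then show "d > 0" "d * real n \<le> e" "d * real n \<le> 1"
        using e by (auto simp: d_def pos_divide_le_eq)
    qed
    from ex_amemiya_le[OF x d(1)] obtain k where k: "k > 0" "amemiya M \<Phi> x k \<le> ennreal d"
      using 0 by auto
    have "1 + I (\<lambda>t. k * x t) = amemiya M \<Phi> x k * ennreal k"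
      unfolding amemiya_def using k by (simp add: ennreal_divide_times)
    also have "\<dots> \<le> ennreal d * ennreal k" by (rule mult_right_mono[OF k(2)]) simp
    finally have le: "1 + I (\<lambda>t. k * x t) \<le> ennreal (d * k)" using d k by (simp add: ennreal_mult)
    have "ennreal 1 \<le> ennreal (d * k)" using order_trans[OF _ le, of 1] by simp
    then have "1 \<le> d * k" using d k by (subst (asm) ennreal_le_iff) auto
    have "real n / k \<le> 1"
    proof -
      have "real n \<le> real n * (d * k)" using mult_left_mono[OF \<open>1 \<le> d * k\<close>, of "real n"] by simp
      also have "\<dots> \<le> k" using mult_right_mono[OF d(3), of k] k by (simp add: mult_ac)
      finally show ?thesis using k by simp
    qed
    have "I (\<lambda>t. real n * x t) = I (\<lambda>t. (real n / k) * (k * x t) + (1 - real n / k) * 0)" using k by simp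
    also have "\<dots> \<le> ennreal (real n / k) * I (\<lambda>t. k * x t) + ennreal (1 - real n / k) * I (\<lambda>t. 0)"
      by (rule modular_convex) (use k \<open>real n / k \<le> 1\<close> in auto)
    also have "\<dots> = ennreal (real n / k) * I (\<lambda>t. k * x t)" by (simp add: modular_def)
    also have "\<dots> \<le> ennreal (real n / k) * ennreal (d * k)"
      by (intro mult_left_mono order_trans[OF _ le]) auto
    also have "\<dots> = ennreal (d * real n)" using k d by (simp add: mult.commute flip: ennreal_mult)
    also have "\<dots> \<le> ennreal e" using d by (intro ennreal_leI) auto
    finally show ?thesis .
  qed
  then have "I (\<lambda>t. real n * x t) = 0" for n
    by (metis ennreal_le_epsilon add_0 le_zero_eq)
  then have "AE t in M. \<Phi> t (ennreal \<bar>real n * x t\<bar>) = 0" for n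
    unfolding modular_def by (subst (asm) nn_integral_0_iff_AE) auto
  then have "AE t in M. \<forall>n. \<Phi> t (ennreal \<bar>real n * x t\<bar>) = 0" by (simp add: AE_all_countable)
  then have "AE t in M. x t = 0"
  proof eventually_elim
    case (elim t)
    show ?case
    proof (rule ccontr)
      assume "x t \<noteq> 0"
      interpret young_function "\<Phi> t" by (rule young)
      \<comment> \<open>Lower semicontinuity at infinity excludes that \<open>\<Phi> t\<close>
        vanishes on all finite arguments.\<close>
      have "\<infinity> \<le> Liminf (at \<infinity>) (\<Phi> t)" using lsc by (metis infinity lower_semicontinuous_ennreal_def)
      then have "0 < Liminf (at \<infinity>) (\<Phi> t)" by (simp add: less_le_trans[of 0 top] top_unique)
      then have "eventually (\<lambda>u. 0 < \<Phi> t u) (at \<infinity>)" by (rule less_LiminfD)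
      then have "eventually (\<lambda>u. 0 < \<Phi> t u) (at_left \<infinity>)" by (metis at_le filter_leD subset_UNIV)
      then obtain b where b: "b < \<infinity>" "\<And>y. b < y \<Longrightarrow> y < \<infinity> \<Longrightarrow> 0 < \<Phi> t y"
        using eventually_at_left[of 0 "\<infinity> :: ennreal"] by auto
      obtain b' where b': "b = ennreal b'" "b' \<ge> 0" using b(1) by (cases b) auto
      obtain n where "b' / \<bar>x t\<bar> < real n" using reals_Archimedean2 by blast
      then have "b' < \<bar>real n * x t\<bar>" using \<open>x t \<noteq> 0\<close> by (simp add: abs_mult field_simps)
      then have "b < ennreal \<bar>real n * x t\<bar>" using b' by (simp add: ennreal_less_iff)
      from b(2)[OF this] elim show False by simp
    qed
  qed
  with nz show False by simp
qed

end

section \<open>The order dual and purely singular functionals\<close>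

context musielak_orlicz_space
begin

abbreviation "dual \<equiv> orlicz_dual M \<Phi>"
abbreviation "pos \<equiv> functional_pos_part M \<Phi>"

lemma dual_add: "f \<in> dual \<Longrightarrow> x \<in> L \<Longrightarrow> y \<in> L \<Longrightarrow> f (\<lambda>t. x t + y t) = f x + f y"
  by (simp add: orlicz_dual_def)

lemma dual_cmult: "f \<in> dual \<Longrightarrow> x \<in> L \<Longrightarrow> f (\<lambda>t. c * x t) = c * f x"
  by (simp add: orlicz_dual_def)

lemma dual_uminus_arg: "f \<in> dual \<Longrightarrow> x \<in> L \<Longrightarrow> f (\<lambda>t. - x t) = - f x"
  using dual_cmult[of f x "-1"] by simp

lemma dual_zero: "f \<in> dual \<Longrightarrow> f (\<lambda>t. 0) = 0"
  using dual_cmult[of f "\<lambda>t. 0" 0] by simp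

lemma dual_diff: "f \<in> dual \<Longrightarrow> x \<in> L \<Longrightarrow> y \<in> L \<Longrightarrow> f (\<lambda>t. x t - y t) = f x - f y"
  using dual_add[of f x "\<lambda>t. - y t"] by (simp add: L_uminus dual_uminus_arg)

lemma dual_bounded:
  assumes "f \<in> dual"
  obtains C where "C \<ge> 0" "\<And>x. x \<in> L \<Longrightarrow> \<bar>f x\<bar> \<le> C * N x"
proof -
  obtain C where C: "\<And>x. x \<in> L \<Longrightarrow> \<bar>f x\<bar> \<le> C * N x" using assms unfolding orlicz_dual_def by blast
  have "\<bar>f x\<bar> \<le> \<bar>C\<bar> * N x" if "x \<in> L" for x
    using order_trans[OF C[OF that] mult_right_mono[OF abs_ge_self norm_nonneg[OF that]]] .
  then show ?thesis by (intro that[of "\<bar>C\<bar>"]) auto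
qed

lemma dual_AE_cong:
  assumes "f \<in> dual" "x \<in> L" "y \<in> L" "AE t in M. x t = y t"
  shows "f x = f y"
proof -
  obtain C where C: "\<And>x. x \<in> L \<Longrightarrow> \<bar>f x\<bar> \<le> C * N x" using dual_bounded[OF assms(1)] by blast
  have "N (\<lambda>t. x t - y t) = 0"
    by (rule norm_eq_0[OF L_diff[OF assms(2,3)]]) (use assms(4) in eventually_elim, auto)
  then have "f (\<lambda>t. x t - y t) = 0" using C[OF L_diff[OF assms(2,3)]] by simp
  then show ?thesis using dual_diff[OF assms(1-3)] by simp
qed

lemma dual_uminus: "f \<in> dual \<Longrightarrow> (\<lambda>x. - f x) \<in> dual"
  by (auto simp: orlicz_dual_def)

lemma bdd_above_dual_norm:
  assumes "f \<in> dual"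
  shows "bdd_above ((\<lambda>x. \<bar>f x\<bar> / N x) ` {x \<in> L. \<not> (AE t in M. x t = 0)})"
proof -
  obtain C where C: "C \<ge> 0" "\<And>x. x \<in> L \<Longrightarrow> \<bar>f x\<bar> \<le> C * N x" using dual_bounded[OF assms] by blast
  have "\<bar>f x\<bar> / N x \<le> C" if "x \<in> L" "\<not> (AE t in M. x t = 0)" for x
    using C(2)[OF that(1)] norm_pos[OF that] by (simp add: divide_simps)
  then show ?thesis by (auto simp: bdd_above_def)
qed

lemma dual_le_norm:
  assumes "f \<in> dual" "x \<in> L"
  shows "\<bar>f x\<bar> \<le> dual_norm M \<Phi> f * N x"
proof (cases "AE t in M. x t = 0")
  case True
  then have "f x = f (\<lambda>t. 0)" using dual_AE_cong[OF assms, of "\<lambda>t. 0"] by simp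
  then show ?thesis using norm_eq_0[OF assms(2) True] dual_zero[OF assms(1)] by simp
next
  case False
  have "\<bar>f x\<bar> / N x \<le> dual_norm M \<Phi> f"
    unfolding dual_norm_def by (rule cSUP_upper[OF _ bdd_above_dual_norm[OF assms(1)]]) (use assms False in auto)
  then show ?thesis using norm_pos[OF assms(2) False] by (simp add: divide_simps)
qed

lemma dual_norm_le:
  assumes "x \<in> L" "\<not> (AE t in M. x t = 0)" "\<And>y. y \<in> L \<Longrightarrow> \<bar>f y\<bar> \<le> C * N y"
  shows "dual_norm M \<Phi> f \<le> C"
  unfolding dual_norm_def
proof (rule cSUP_least)
  show "{u \<in> L. \<not> (AE t in M. u t = 0)} \<noteq> {}" using assms(1,2) by auto
  show "\<bar>f y\<bar> / N y \<le> C" if "y \<in> {u \<in> L. \<not> (AE t in M. u t = 0)}" for y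
    using assms(3)[of y] norm_pos[of y] that by (simp add: divide_simps)
qed

lemma dual_norm_nonneg:
  assumes "f \<in> dual" "x \<in> L" "\<not> (AE t in M. x t = 0)"
  shows "0 \<le> dual_norm M \<Phi> f"
proof -
  have "0 \<le> \<bar>f x\<bar>" by simp
  also note dual_le_norm[OF assms(1,2)]
  finally show ?thesis using norm_pos[OF assms(2,3)] by (simp add: zero_le_mult_iff)
qed

section \<open>The positive part of a functional on the positive cone\<close>

lemma bdd_above_pos:
  assumes f: "f \<in> dual" and u: "u \<in> L"
  shows "bdd_above (f ` {w \<in> L. AE t in M. 0 \<le> w t \<and> w t \<le> u t})"
proof -
  obtain C where C: "C \<ge> 0" "\<And>x. x \<in> L \<Longrightarrow> \<bar>f x\<bar> \<le> C * N x" using dual_bounded[OF f] by blast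
  have "f w \<le> C * N u" if "w \<in> L" "AE t in M. 0 \<le> w t \<and> w t \<le> u t" for w
  proof -
    have "N w \<le> N u" by (rule norm_mono[OF that(1) u]) (use that(2) in eventually_elim, auto)
    then have "C * N w \<le> C * N u" using C(1) by (rule mult_left_mono)
    then show ?thesis using C(2)[OF that(1)] by simp
  qed
  then show ?thesis by (auto simp: bdd_above_def)
qed

lemma pos_upper:
  assumes "f \<in> dual" "u \<in> L" "w \<in> L" "AE t in M. 0 \<le> w t \<and> w t \<le> u t"
  shows "f w \<le> pos f u"
  unfolding functional_pos_part_def
  by (rule cSUP_upper[OF _ bdd_above_pos[OF assms(1,2)]]) (use assms in auto)

lemma pos_least:
  assumes "AE t in M. 0 \<le> u t" "\<And>w. w \<in> L \<Longrightarrow> AE t in M. 0 \<le> w t \<and> w t \<le> u t \<Longrightarrow> f w \<le> c"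
  shows "pos f u \<le> c"
  unfolding functional_pos_part_def
proof (rule cSUP_least)
  have "(\<lambda>t. 0) \<in> {w \<in> L. AE t in M. 0 \<le> w t \<and> w t \<le> u t}" using assms(1) by simp
  then show "{w \<in> L. AE t in M. 0 \<le> w t \<and> w t \<le> u t} \<noteq> {}" by blast
qed (use assms(2) in auto)

lemma pos_nonneg:
  assumes "f \<in> dual" "u \<in> L" "AE t in M. 0 \<le> u t"
  shows "0 \<le> pos f u"
  using pos_upper[OF assms(1,2) L_zero] assms(3) dual_zero[OF assms(1)] by simp

lemma pos_mono:
  assumes "f \<in> dual" "y \<in> L" "AE t in M. 0 \<le> x t \<and> x t \<le> y t"
  shows "pos f x \<le> pos f y"
proof (rule pos_least)
  show "AE t in M. 0 \<le> x t" using assms(3) by eventually_elim auto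
  fix w assume w: "w \<in> L" "AE t in M. 0 \<le> w t \<and> w t \<le> x t"
  show "f w \<le> pos f y"
    by (rule pos_upper[OF assms(1,2) w(1)]) (use w(2) assms(3) in eventually_elim, auto)
qed

text \<open>Riesz decomposition: a function between 0 and \<open>x + y\<close> splits into
  \<open>min w x\<close> and a remainder between 0 and \<open>y\<close>.\<close>

lemma pos_add:
  assumes f: "f \<in> dual" and x: "x \<in> L" "AE t in M. 0 \<le> x t" and y: "y \<in> L" "AE t in M. 0 \<le> y t"
  shows "pos f (\<lambda>t. x t + y t) = pos f x + pos f y"
proof (rule antisym)
  show "pos f (\<lambda>t. x t + y t) \<le> pos f x + pos f y"
  proof (rule pos_least)
    show "AE t in M. 0 \<le> x t + y t" using x(2) y(2) by eventually_elim simp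
    fix w assume w: "w \<in> L" "AE t in M. 0 \<le> w t \<and> w t \<le> x t + y t"
    have 1: "f (\<lambda>t. min (w t) (x t)) \<le> pos f x"
      by (rule pos_upper[OF f x(1) L_min[OF w(1) x(1)]]) (use w(2) x(2) in eventually_elim, auto)
    have 2: "f (\<lambda>t. w t - min (w t) (x t)) \<le> pos f y"
      by (rule pos_upper[OF f y(1) L_diff[OF w(1) L_min[OF w(1) x(1)]]])
        (use w(2) x(2) y(2) in eventually_elim, auto)
    show "f w \<le> pos f x + pos f y"
      using 1 2 dual_diff[OF f w(1) L_min[OF w(1) x(1)]] by simp
  qed
  have "pos f x \<le> pos f (\<lambda>t. x t + y t) - pos f y"
  proof (rule pos_least[OF x(2)])
    fix w assume w: "w \<in> L" "AE t in M. 0 \<le> w t \<and> w t \<le> x t"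
    have "pos f y \<le> pos f (\<lambda>t. x t + y t) - f w"
    proof (rule pos_least[OF y(2)])
      fix z assume z: "z \<in> L" "AE t in M. 0 \<le> z t \<and> z t \<le> y t"
      have "f (\<lambda>t. w t + z t) \<le> pos f (\<lambda>t. x t + y t)"
        by (rule pos_upper[OF f L_add[OF x(1) y(1)] L_add[OF w(1) z(1)]])
          (use w(2) z(2) in eventually_elim, auto)
      then show "f z \<le> pos f (\<lambda>t. x t + y t) - f w" using dual_add[OF f w(1) z(1)] by simp
    qed
    then show "f w \<le> pos f (\<lambda>t. x t + y t) - pos f y" by simp
  qed
  then show "pos f x + pos f y \<le> pos f (\<lambda>t. x t + y t)" by simp
qed

text \<open>The substitution of \<open>u - w\<close> for \<open>w\<close> maps the order interval
  from 0 to \<open>u\<close> onto itself.\<close>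

lemma pos_minus_neg:
  assumes f: "f \<in> dual" and u: "u \<in> L" "AE t in M. 0 \<le> u t"
  shows "pos f u - pos (\<lambda>w. - f w) u = f u"
proof -
  have "pos g u \<le> g u + pos (\<lambda>w. - g w) u" if g: "g \<in> dual" for g
  proof (rule pos_least[OF u(2)])
    fix w assume w: "w \<in> L" "AE t in M. 0 \<le> w t \<and> w t \<le> u t"
    have "- g (\<lambda>t. u t - w t) \<le> pos (\<lambda>w. - g w) u"
      by (rule pos_upper[OF dual_uminus[OF g] u(1) L_diff[OF u(1) w(1)]])
        (use w(2) in eventually_elim, auto)
    then show "g w \<le> g u + pos (\<lambda>w. - g w) u" using dual_diff[OF g u(1) w(1)] by simp
  qed
  from this[OF f] this[OF dual_uminus[OF f]] show ?thesis by simp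
qed

text \<open>The bound \<open>pos f u\<close> makes the real supremum over \<open>n\<close> genuine,
  and the lower bound 0 does the same for the infimum over sequences.\<close>

lemma oc_part_cone_le_SUP:
  assumes f: "f \<in> dual" and u: "u \<in> L"
    and x: "\<And>n. x n \<in> L" "AE t in M. (\<forall>n. 0 \<le> x n t) \<and> incseq (\<lambda>n. x n t) \<and> (\<lambda>n. x n t) \<longlonglongrightarrow> u t"
  shows "pos f (x n) \<le> (SUP n. pos f (x n))" "0 \<le> (SUP n. pos f (x n))"
proof -
  have le: "pos f (x n) \<le> pos f u" for n
    by (rule pos_mono[OF f u]) (use x(2) in eventually_elim, auto intro: incseq_le)
  then have bdd: "bdd_above (range (\<lambda>n. pos f (x n)))" by (auto simp: bdd_above_def)
  show "pos f (x n) \<le> (SUP n. pos f (x n))" for n by (rule cSUP_upper[OF _ bdd]) simp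
  have "0 \<le> pos f (x 0)"
    by (rule pos_nonneg[OF f x(1)]) (use x(2) in eventually_elim, auto)
  also have "\<dots> \<le> (SUP n. pos f (x n))" by (rule cSUP_upper[OF _ bdd]) simp
  finally show "0 \<le> (SUP n. pos f (x n))" .
qed

lemma oc_part_cone_le:
  assumes f: "f \<in> dual" and u: "u \<in> L" "AE t in M. 0 \<le> u t"
  shows "oc_part_cone M \<Phi> (pos f) u \<le> pos f u"
proof -
  have "oc_part_cone M \<Phi> (pos f) u \<le> (SUP n::nat. pos f u)"
    unfolding oc_part_cone_def
  proof (rule cINF_lower2[where x = "\<lambda>n. u"])
    show "bdd_below ((\<lambda>x. SUP n. pos f (x n)) ` {x. (\<forall>n. x n \<in> L) \<and>
       (AE t in M. (\<forall>n. 0 \<le> x n t) \<and> incseq (\<lambda>n. x n t) \<and> (\<lambda>n. x n t) \<longlonglongrightarrow> u t)})"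
      using oc_part_cone_le_SUP(2)[OF f u(1)] by (auto simp: bdd_below_def)
    show "(\<lambda>n. u) \<in> {x. (\<forall>n. x n \<in> L) \<and>
       (AE t in M. (\<forall>n. 0 \<le> x n t) \<and> incseq (\<lambda>n. x n t) \<and> (\<lambda>n. x n t) \<longlonglongrightarrow> u t)}"
      using u(1) by (auto simp: incseq_def intro: eventually_mono[OF u(2)])
  qed simp
  then show ?thesis by simp
qed

lemma oc_part_cone_less:
  assumes f: "f \<in> dual" and u: "u \<in> L" "AE t in M. 0 \<le> u t" and less: "oc_part_cone M \<Phi> (pos f) u < c"
  obtains x where "\<And>n. x n \<in> L" "\<And>n. pos f (x n) \<le> c"
    "AE t in M. (\<forall>n. 0 \<le> x n t) \<and> incseq (\<lambda>n. x n t) \<and> (\<lambda>n. x n t) \<longlonglongrightarrow> u t"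
proof -
  let ?S = "{x. (\<forall>n. x n \<in> L) \<and>
       (AE t in M. (\<forall>n. 0 \<le> x n t) \<and> incseq (\<lambda>n. x n t) \<and> (\<lambda>n. x n t) \<longlonglongrightarrow> u t)}"
  have u_in: "(\<lambda>n. u) \<in> ?S"
    using u(1) by (auto simp: incseq_def intro: eventually_mono[OF u(2)])
  have "?S \<noteq> {}"
  proof
    assume "?S = {}"
    with u_in show False by (simp only: empty_iff)
  qed
  moreover have "bdd_below ((\<lambda>x. SUP n. pos f (x n)) ` ?S)"
    using oc_part_cone_le_SUP(2)[OF f u(1)] by (auto simp: bdd_below_def)
  ultimately obtain x where x: "x \<in> ?S" "(SUP n. pos f (x n)) < c"
    using less unfolding oc_part_cone_def by (subst (asm) cINF_less_iff) auto
  then have "pos f (x n) \<le> c" for n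
    using oc_part_cone_le_SUP(1)[OF f u(1), of x n] by auto
  with x show ?thesis by (intro that[of x]) auto
qed

lemma oc_part_cone_nonneg:
  assumes f: "f \<in> dual" and u: "u \<in> L" "AE t in M. 0 \<le> u t"
  shows "0 \<le> oc_part_cone M \<Phi> (pos f) u"
proof (rule ccontr)
  assume "\<not> ?thesis"
  \<comment> \<open>Half of a negative infimum is larger than it and still negative, so some
    sequence would have negative values of \<open>pos f\<close>.\<close>
  then have "oc_part_cone M \<Phi> (pos f) u < oc_part_cone M \<Phi> (pos f) u / 2" by simp
  from oc_part_cone_less[OF f u this] obtain x where x: "\<And>n. x n \<in> L" "\<And>n. pos f (x n) \<le> oc_part_cone M \<Phi> (pos f) u / 2"
    "AE t in M. (\<forall>n. 0 \<le> x n t) \<and> incseq (\<lambda>n. x n t) \<and> (\<lambda>n. x n t) \<longlonglongrightarrow> u t" by blast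
  have "0 \<le> pos f (x 0)" by (rule pos_nonneg[OF f x(1)]) (use x(3) in eventually_elim, auto)
  with x(2)[of 0] \<open>\<not> ?thesis\<close> show False by simp
qed

lemma oc_part_cone_zero:
  assumes f: "f \<in> dual"
  shows "oc_part_cone M \<Phi> (pos f) (\<lambda>t. 0) = 0"
proof (rule antisym)
  have "pos f (\<lambda>t. 0) \<le> 0"
  proof (rule pos_least)
    fix w assume w: "w \<in> L" "AE t in M. 0 \<le> w t \<and> w t \<le> (0::real)"
    have "f w = f (\<lambda>t. 0)"
      by (rule dual_AE_cong[OF f w(1) L_zero]) (use w(2) in eventually_elim, auto)
    then show "f w \<le> 0" using dual_zero[OF f] by simp
  qed simp
  then show "oc_part_cone M \<Phi> (pos f) (\<lambda>t. 0) \<le> 0"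
    using oc_part_cone_le[OF f L_zero] by simp
  show "0 \<le> oc_part_cone M \<Phi> (pos f) (\<lambda>t. 0)"
    by (rule oc_part_cone_nonneg[OF f L_zero]) simp
qed

text \<open>The definition only makes two order continuous parts cancel. At \<open>u >= 0\<close>
  the negative part of \<open>u\<close> contributes 0, which leaves equality on the cone.\<close>

lemma purely_singular_cone_eq:
  assumes fs: "purely_singular M \<Phi> f" and u: "u \<in> L" "\<And>t. 0 \<le> u t"
  shows "oc_part_cone M \<Phi> (pos f) u = oc_part_cone M \<Phi> (pos (\<lambda>w. - f w)) u"
proof -
  have f: "f \<in> dual" and 0: "order_continuous_part M \<Phi> f u = 0"
    using fs u(1) by (auto simp: purely_singular_def)
  have "(\<lambda>t. max (u t) 0) = u" "(\<lambda>t. max (- u t) 0) = (\<lambda>t. 0)" using u(2) by (auto simp: fun_eq_iff)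
  then show ?thesis
    using 0 oc_part_cone_zero[OF f] oc_part_cone_zero[OF dual_uminus[OF f]]
    by (simp add: order_continuous_part_def oc_part_pos_def)
qed

lemma purely_singular_uminus:
  assumes "purely_singular M \<Phi> f"
  shows "purely_singular M \<Phi> (\<lambda>w. - f w)"
  using assms dual_uminus by (auto simp: purely_singular_def order_continuous_part_def)

text \<open>The order continuous parts of \<open>f\<^sup>+\<close> and \<open>f\<^sup>-\<close> agree and \<open>f\<^sup>+ \<and> f\<^sup>- = 0\<close>, so both
  vanish: split \<open>u\<close> into \<open>w\<close> and \<open>u - w\<close> with \<open>f\<^sup>-\<close> small on \<open>w\<close> and \<open>f\<^sup>+\<close> small on \<open>u - w\<close>.\<close>

lemma purely_singular_ex_incseq:
  assumes fs: "purely_singular M \<Phi> f" and u: "u \<in> L" "\<And>t. 0 \<le> u t" and e: "e > 0"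
  obtains x where "\<And>n. x n \<in> L" "\<And>n. pos f (x n) \<le> e"
    "AE t in M. (\<forall>n. 0 \<le> x n t) \<and> incseq (\<lambda>n. x n t) \<and> (\<lambda>n. x n t) \<longlonglongrightarrow> u t"
proof -
  have f: "f \<in> dual" using fs by (simp add: purely_singular_def)
  have "\<exists>w0. w0 \<in> L \<and> (AE t in M. 0 \<le> w0 t \<and> w0 t \<le> u t) \<and> pos f u - e / 3 < f w0"
  proof (rule ccontr)
    assume "\<not> ?thesis"
    then have "pos f u \<le> pos f u - e / 3" by (intro pos_least) (use u(2) in \<open>auto simp: not_less\<close>)
    then show False using e by simp
  qed
  then obtain w0 where w0: "w0 \<in> L" "AE t in M. 0 \<le> w0 t \<and> w0 t \<le> u t" "pos f u - e / 3 < f w0" by blast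
  \<comment> \<open>\<open>w0\<close> obeys its bounds only almost everywhere; clamping makes them
    hold everywhere without changing the value of \<open>f\<close>.\<close>
  define w where "w t = max 0 (min (w0 t) (u t))" for t
  have w: "w \<in> L" "\<And>t. 0 \<le> w t" "\<And>t. w t \<le> u t"
    using L_max[OF L_zero L_min[OF w0(1) u(1)]] u(2) by (auto simp: w_def[abs_def])
  have "f w = f w0"
    by (rule dual_AE_cong[OF f w(1) w0(1)]) (use w0(2) in eventually_elim, auto simp: w_def)
  then have fw: "pos f u - e / 3 < f w" using w0(3) by simp
  define z where "z t = u t - w t" for t
  have z: "z \<in> L" "\<And>t. 0 \<le> z t" using L_diff[OF u(1) w(1)] w by (auto simp: z_def[abs_def])
  have "pos f u = pos f w + pos f z"
    using pos_add[OF f w(1) _ z(1)] w(2) z(2) by (simp add: z_def[abs_def])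
  moreover have "f w \<le> pos f w" by (rule pos_upper[OF f w(1) w(1)]) (use w in auto)
  moreover have "0 \<le> pos f z" by (rule pos_nonneg[OF f z(1)]) (use z in auto)
  moreover have "pos f w - pos (\<lambda>x. - f x) w = f w" by (rule pos_minus_neg[OF f w(1)]) (use w in auto)
  \<comment> \<open>Since \<open>w\<close> nearly attains \<open>pos f u\<close>, little of the
    positive part is left for \<open>z\<close>, and \<open>pos f w - f w\<close>, the negative part
    at \<open>w\<close>, is small too.\<close>
  ultimately have small: "pos f z < e / 3" "pos (\<lambda>x. - f x) w < e / 3" using fw by auto
  have "oc_part_cone M \<Phi> (pos f) w = oc_part_cone M \<Phi> (pos (\<lambda>x. - f x)) w"
    by (rule purely_singular_cone_eq[OF fs w(1,2)])
  also have "\<dots> \<le> pos (\<lambda>x. - f x) w"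
    by (rule oc_part_cone_le[OF dual_uminus[OF f] w(1)]) (use w in auto)
  also note small(2)
  finally obtain x where x: "\<And>n. x n \<in> L" "\<And>n. pos f (x n) \<le> e / 3"
    "AE t in M. (\<forall>n. 0 \<le> x n t) \<and> incseq (\<lambda>n. x n t) \<and> (\<lambda>n. x n t) \<longlonglongrightarrow> w t"
    using oc_part_cone_less[OF f w(1), of "e / 3"] w(2) by auto
  show ?thesis
  proof (rule that[of "\<lambda>n t. x n t + z t"])
    show "(\<lambda>t. x n t + z t) \<in> L" for n by (rule L_add[OF x(1) z(1)])
    have x0: "AE t in M. 0 \<le> x n t" for n using x(3) by eventually_elim auto
    have "pos f (\<lambda>t. x n t + z t) = pos f (x n) + pos f z" for n
      by (rule pos_add[OF f x(1) x0 z(1)]) (use z(2) in auto)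
    then show "pos f (\<lambda>t. x n t + z t) \<le> e" for n using x(2)[of n] small(1) e by simp
    show "AE t in M. (\<forall>n. 0 \<le> x n t + z t) \<and> incseq (\<lambda>n. x n t + z t) \<and> (\<lambda>n. x n t + z t) \<longlonglongrightarrow> u t"
      using x(3)
    proof eventually_elim
      case (elim t)
      then have "(\<lambda>n. x n t + z t) \<longlonglongrightarrow> w t + z t" by (intro tendsto_intros) auto
      then show ?case using elim z(2)[of t] by (auto simp: incseq_def z_def)
    qed
  qed
qed

text \<open>The form in which singularity is used below. Both parts of \<open>f\<close> are small on
  functions \<open>z n\<close> that tend to \<open>u\<close>, and the set where \<open>z n\<close>
  is far below \<open>u\<close> becomes negligible for \<open>G\<close> by dominated
  convergence.\<close>

lemma purely_singular_small_set:
  assumes fs: "purely_singular M \<Phi> f" and u: "u \<in> L" "\<And>t. 0 \<le> u t" and e: "e > 0"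
    and G [measurable]: "G \<in> borel_measurable M" and Gfin: "(\<integral>\<^sup>+ t. G t \<partial>M) < \<infinity>"
  obtains E where "E \<in> sets M" "(\<integral>\<^sup>+ t. G t * indicator E t \<partial>M) \<le> ennreal e"
    "\<And>y. y \<in> L \<Longrightarrow> (\<And>t. t \<in> space M \<Longrightarrow> \<bar>y t\<bar> \<le> u t) \<Longrightarrow> (\<And>t. t \<in> E \<Longrightarrow> y t = 0) \<Longrightarrow> \<bar>f y\<bar> \<le> e"
proof -
  have f: "f \<in> dual" using fs by (simp add: purely_singular_def)
  have e4: "e / 4 > 0" using e by simp
  obtain x where x: "\<And>n. x n \<in> L" "\<And>n. pos f (x n) \<le> e / 4"
    "AE t in M. (\<forall>n. 0 \<le> x n t) \<and> incseq (\<lambda>n. x n t) \<and> (\<lambda>n. x n t) \<longlonglongrightarrow> u t"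
    using purely_singular_ex_incseq[OF fs u e4] by blast
  obtain x' where x': "\<And>n. x' n \<in> L" "\<And>n. pos (\<lambda>w. - f w) (x' n) \<le> e / 4"
    "AE t in M. (\<forall>n. 0 \<le> x' n t) \<and> incseq (\<lambda>n. x' n t) \<and> (\<lambda>n. x' n t) \<longlonglongrightarrow> u t"
    using purely_singular_ex_incseq[OF purely_singular_uminus[OF fs] u e4] by blast
  define z where "z n t = min (x n t) (x' n t)" for n t
  have z: "z n \<in> L" for n unfolding z_def using L_min[OF x(1) x'(1)] .
  have z_lim: "AE t in M. (\<forall>n. 0 \<le> z n t) \<and> (\<lambda>n. z n t) \<longlonglongrightarrow> u t"
    using x(3) x'(3)
  proof eventually_elim
    case (elim t)
    then have "(\<lambda>n. min (x n t) (x' n t)) \<longlonglongrightarrow> min (u t) (u t)" by (intro tendsto_min) auto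
    with elim show ?case by (auto simp: z_def)
  qed
  have z_small: "pos f (z n) \<le> e / 4" "pos (\<lambda>w. - f w) (z n) \<le> e / 4" for n
  proof -
    have "pos f (z n) \<le> pos f (x n)"
      by (rule pos_mono[OF f x(1)]) (use x(3) x'(3) in eventually_elim, auto simp: z_def)
    then show "pos f (z n) \<le> e / 4" using x(2)[of n] by simp
    have "pos (\<lambda>w. - f w) (z n) \<le> pos (\<lambda>w. - f w) (x' n)"
      by (rule pos_mono[OF dual_uminus[OF f] x'(1)]) (use x(3) x'(3) in eventually_elim, auto simp: z_def)
    then show "pos (\<lambda>w. - f w) (z n) \<le> e / 4" using x'(2)[of n] by simp
  qed
  note [measurable] = L_measurable[OF z] L_measurable[OF u(1)]
  \<comment> \<open>The factor 2 makes almost every point leave \<open>E n\<close> eventually. Off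
    \<open>E n\<close> a function dominated by \<open>u\<close> is dominated by
    \<open>2 * z n\<close>, where each part of \<open>f\<close> is at most \<open>e / 2\<close>; the
    positive and negative parts of \<open>y\<close> then add up to \<open>e\<close>.\<close>
  define E where "E n = {t \<in> space M. 2 * z n t < u t}" for n
  have [measurable]: "E n \<in> sets M" for n unfolding E_def by measurable
  have "(\<lambda>n. \<integral>\<^sup>+ t. G t * indicator (E n) t \<partial>M) \<longlonglongrightarrow> (\<integral>\<^sup>+ t. 0 \<partial>M)"
  proof (rule nn_integral_dominated_convergence[where w = G])
    show "AE t in M. (\<lambda>n. G t * indicator (E n) t) \<longlonglongrightarrow> 0"
      using z_lim
    proof eventually_elim
      case (elim t)
      have "eventually (\<lambda>n. t \<notin> E n) sequentially"
      proof (cases "u t > 0")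
        case True
        have "eventually (\<lambda>n. u t / 2 < z n t) sequentially"
          by (rule order_tendstoD(1)) (use elim True in auto)
        then show ?thesis by eventually_elim (auto simp: E_def)
      next
        case False
        have "0 \<le> z n t" for n using elim by auto
        then have "t \<notin> E n" for n using False by (auto simp: E_def not_less intro: order_trans)
        then show ?thesis by simp
      qed
      then have "eventually (\<lambda>n. G t * indicator (E n) t = 0) sequentially"
        by eventually_elim simp
      then show ?case by (rule tendsto_eventually)
    qed
  qed (use Gfin in \<open>auto simp: indicator_def\<close>)
  then have "eventually (\<lambda>n. (\<integral>\<^sup>+ t. G t * indicator (E n) t \<partial>M) < ennreal e) sequentially"
    by (intro order_tendstoD(2)) (use e in \<open>auto simp: ennreal_less_zero_iff\<close>)
  then obtain n where n: "(\<integral>\<^sup>+ t. G t * indicator (E n) t \<partial>M) < ennreal e"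
    using eventually_happens'[OF sequentially_bot] by blast
  show ?thesis
  proof (rule that[of "E n"])
    fix y assume y: "y \<in> L" "\<And>t. t \<in> space M \<Longrightarrow> \<bar>y t\<bar> \<le> u t" "\<And>t. t \<in> E n \<Longrightarrow> y t = 0"
    have y_le: "AE t in M. \<bar>y t\<bar> \<le> z n t + z n t"
      using z_lim AE_space
    proof eventually_elim
      case (elim t)
      then show ?case using y(2)[of t] y(3)[of t] by (cases "t \<in> E n") (auto simp: E_def)
    qed
    have bound: "\<bar>f y'\<bar> \<le> e / 2" if y': "y' \<in> L" "AE t in M. 0 \<le> y' t" "AE t in M. y' t \<le> z n t + z n t" for y'
    proof -
      have z0: "AE t in M. 0 \<le> z n t" using z_lim by eventually_elim auto
      have d: "(\<lambda>w. - f w) \<in> dual" by (rule dual_uminus[OF f])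
      have "f y' \<le> pos f (\<lambda>t. z n t + z n t)"
        by (rule pos_upper[OF f L_add[OF z z] y'(1)]) (use y'(2,3) in eventually_elim, auto)
      moreover have "- f y' \<le> pos (\<lambda>w. - f w) (\<lambda>t. z n t + z n t)"
        by (rule pos_upper[OF d L_add[OF z z] y'(1)]) (use y'(2,3) in eventually_elim, auto)
      ultimately show ?thesis
        using z_small[of n] pos_add[OF f z z0 z z0] pos_add[OF d z z0 z z0] by simp
    qed
    have yp: "(\<lambda>t. max (y t) 0) \<in> L" "(\<lambda>t. max (- y t) 0) \<in> L"
      using L_max[OF y(1) L_zero] L_max[OF L_uminus[OF y(1)] L_zero] by auto
    have "(\<lambda>t. max (y t) 0 - max (- y t) 0) = y" by (auto simp: fun_eq_iff max_def)
    then have "f y = f (\<lambda>t. max (y t) 0) - f (\<lambda>t. max (- y t) 0)"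
      using dual_diff[OF f yp] by simp
    moreover have "\<bar>f (\<lambda>t. max (y t) 0)\<bar> \<le> e / 2"
      by (rule bound[OF yp(1)], simp, use y_le in eventually_elim, auto)
    moreover have "\<bar>f (\<lambda>t. max (- y t) 0)\<bar> \<le> e / 2"
      by (rule bound[OF yp(2)], simp, use y_le in eventually_elim, auto)
    ultimately show "\<bar>f y\<bar> \<le> e" by linarith
  qed (use n in auto)
qed

end

section \<open>The norm of a functional with a singular part\<close>

context musielak_orlicz_space
begin

lemma norm_le_modular:
  assumes "y \<in> L"
  shows "ennreal (N y) \<le> 1 + I y"
  using norm_le_amemiya[OF assms, of 1] by (simp add: amemiya_def divide_ennreal_def)

lemma modular_indicator:
  "I (\<lambda>t. y t * indicator E t) = (\<integral>\<^sup>+ t. \<Phi> t (ennreal \<bar>y t\<bar>) * indicator E t \<partial>M)"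
  unfolding modular_def by (rule nn_integral_cong) (simp add: indicator_def)

text \<open>A finite modular, however large, counts as norm 1 for a singular functional:
  \<open>y\<close> may be cut down to a set \<open>E\<close> of small modular, where its norm is at
  most \<open>1 + e\<close>, at the price of \<open>e\<close> in the value.\<close>

lemma purely_singular_le_dual_norm:
  assumes fs: "purely_singular M \<Phi> f" and y: "y \<in> borel_measurable M" "I y < \<infinity>"
    and nonzero: "u \<in> L" "\<not> (AE t in M. u t = 0)"
  shows "\<bar>f y\<bar> \<le> dual_norm M \<Phi> f"
proof -
  have f: "f \<in> dual" using fs by (simp add: purely_singular_def)
  note [measurable] = y(1)
  have yL: "y \<in> L" by (rule L_if_modular_finite[OF y])
  define D where "D = dual_norm M \<Phi> f"
  have D: "D \<ge> 0" unfolding D_def by (rule dual_norm_nonneg[OF f nonzero])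
  have *: "\<bar>f y\<bar> \<le> e + D * (1 + e)" if e: "e > 0" for e
  proof -
    have G: "(\<lambda>t. \<Phi> t (ennreal \<bar>y t\<bar>)) \<in> borel_measurable M" by measurable
    have Gf: "(\<integral>\<^sup>+ t. \<Phi> t (ennreal \<bar>y t\<bar>) \<partial>M) < \<infinity>" using y(2) by (simp add: modular_def)
    obtain E where E: "E \<in> sets M" "(\<integral>\<^sup>+ t. \<Phi> t (ennreal \<bar>y t\<bar>) * indicator E t \<partial>M) \<le> ennreal e"
      "\<And>z. z \<in> L \<Longrightarrow> (\<And>t. t \<in> space M \<Longrightarrow> \<bar>z t\<bar> \<le> \<bar>y t\<bar>) \<Longrightarrow> (\<And>t. t \<in> E \<Longrightarrow> z t = 0) \<Longrightarrow> \<bar>f z\<bar> \<le> e"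
      using purely_singular_small_set[OF fs L_abs[OF yL] abs_ge_zero e G Gf] by blast
    define y1 where "y1 t = y t * indicator E t" for t
    have y1: "y1 \<in> L" unfolding y1_def by (rule L_indicator[OF yL E(1)])
    have "\<bar>f (\<lambda>t. y t - y1 t)\<bar> \<le> e"
      by (rule E(3)[OF L_diff[OF yL y1]]) (auto simp: y1_def indicator_def)
    then have 1: "\<bar>f y - f y1\<bar> \<le> e" using dual_diff[OF f yL y1] by simp
    have "ennreal (N y1) \<le> 1 + I y1" by (rule norm_le_modular[OF y1])
    also have "\<dots> \<le> 1 + ennreal e" using E(2) by (simp add: y1_def[abs_def] modular_indicator)
    also have "\<dots> = ennreal (1 + e)" using e by simp
    finally have "N y1 \<le> 1 + e" using e by (subst (asm) ennreal_le_iff) auto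
    then have "D * N y1 \<le> D * (1 + e)" using D by (rule mult_left_mono)
    then have "\<bar>f y1\<bar> \<le> D * (1 + e)" using dual_le_norm[OF f y1] by (simp add: D_def)
    with 1 show ?thesis by linarith
  qed
  have "\<bar>f y\<bar> \<le> D"
  proof (rule field_le_epsilon)
    fix e :: real assume e: "e > 0"
    \<comment> \<open>The division by \<open>1 + D\<close> makes the two errors add up to
      \<open>e\<close>.\<close>
    have "\<bar>f y\<bar> \<le> e / (1 + D) + D * (1 + e / (1 + D))" by (rule *) (use e D in auto)
    also have "\<dots> = D + (1 + D) * (e / (1 + D))" by (simp add: algebra_simps add_divide_distrib)
    also have "\<dots> = D + e" using D by simp
    finally show "\<bar>f y\<bar> \<le> D + e" .
  qed
  then show ?thesis by (simp add: D_def)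
qed

text \<open>The preceding bound does not depend on the size of the modular, so it holds for every
  multiple of \<open>u\<close>; the factor \<open>k\<close> below is chosen to make the value
  \<open>D + 1\<close>.\<close>

lemma purely_singular_eq_0:
  assumes fs: "purely_singular M \<Phi> f" and u: "u \<in> L" "\<not> (AE t in M. u t = 0)"
    and fin: "\<And>k. k > 0 \<Longrightarrow> I (\<lambda>t. k * u t) < \<infinity>"
  shows "f u = 0"
proof (rule ccontr)
  assume nz: "f u \<noteq> 0"
  have f: "f \<in> dual" using fs by (simp add: purely_singular_def)
  note [measurable] = L_measurable[OF u(1)]
  define D where "D = dual_norm M \<Phi> f"
  have D: "D \<ge> 0" unfolding D_def by (rule dual_norm_nonneg[OF f u])
  define k where "k = (D + 1) / \<bar>f u\<bar>"
  have k: "k > 0" using D nz by (simp add: k_def)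
  have "\<bar>f (\<lambda>t. k * u t)\<bar> \<le> D"
    unfolding D_def by (rule purely_singular_le_dual_norm[OF fs _ fin[OF k] u]) simp
  then have "k * \<bar>f u\<bar> \<le> D" using dual_cmult[OF f u(1)] k by (simp add: abs_mult)
  then show False using nz by (simp add: k_def)
qed

text \<open>Young's inequality and the singular bound give \<open>|f y| <= 1 + I y\<close> whenever
  \<open>I y\<close> is finite. Inserting \<open>y = k * w\<close>, dividing by \<open>k\<close> and
  taking the infimum produces the norm.\<close>

lemma dual_le_norm_if_modular_le:
  assumes fs: "purely_singular M \<Phi> fs" and f: "f \<in> dual"
    and v: "v \<in> orlicz_space M \<Psi>"
    and dec: "\<And>w. w \<in> L \<Longrightarrow> f w = (\<integral>t. w t * v t \<partial>M) + fs w"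
    and le: "J v + ennreal (dual_norm M \<Phi> fs) \<le> 1"
    and nonzero: "u \<in> L" "\<not> (AE t in M. u t = 0)" and w: "w \<in> L"
  shows "\<bar>f w\<bar> \<le> N w"
proof -
  have v_meas [measurable]: "v \<in> borel_measurable M" using v by (simp add: orlicz_space_def)
  note [measurable] = L_measurable[OF w]
  have D: "dual_norm M \<Phi> fs \<ge> 0"
    by (rule dual_norm_nonneg[OF _ nonzero]) (use fs in \<open>simp add: purely_singular_def\<close>)
  have main: "ennreal \<bar>f y\<bar> \<le> 1 + I y" if y: "y \<in> borel_measurable M" "I y < \<infinity>" for y
  proof -
    have yL: "y \<in> L" by (rule L_if_modular_finite[OF y])
    have "ennreal \<bar>\<integral>t. y t * v t \<partial>M\<bar> \<le> (\<integral>\<^sup>+ t. ennreal (\<bar>y t\<bar> * \<bar>v t\<bar>) \<partial>M)"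
      using abs_integral_le_nn_integral[of "\<lambda>t. y t * v t"] by (simp add: abs_mult)
    also have "\<dots> \<le> I y + J v" by (rule nn_integral_young[OF y(1) v_meas])
    finally have 1: "ennreal \<bar>\<integral>t. y t * v t \<partial>M\<bar> \<le> I y + J v" .
    have 2: "ennreal \<bar>fs y\<bar> \<le> ennreal (dual_norm M \<Phi> fs)"
      by (intro ennreal_leI purely_singular_le_dual_norm[OF fs y nonzero])
    have "ennreal \<bar>f y\<bar> \<le> ennreal (\<bar>\<integral>t. y t * v t \<partial>M\<bar> + \<bar>fs y\<bar>)"
      unfolding dec[OF yL] by (intro ennreal_leI abs_triangle_ineq)
    also have "\<dots> \<le> (I y + J v) + ennreal (dual_norm M \<Phi> fs)"
      using add_mono[OF 1 2] by (simp add: ennreal_plus)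
    also have "\<dots> = I y + (J v + ennreal (dual_norm M \<Phi> fs))" by (simp add: add.assoc)
    also have "\<dots> \<le> I y + 1" by (intro add_left_mono le)
    finally show ?thesis by (simp add: add.commute)
  qed
  have "ennreal \<bar>f w\<bar> \<le> (INF k\<in>{0<..}. amemiya M \<Phi> w k)"
  proof (rule INF_greatest)
    fix k :: real assume "k \<in> {0<..}"
    then have k: "k > 0" by simp
    have "ennreal k * ennreal \<bar>f w\<bar> = ennreal \<bar>f (\<lambda>t. k * w t)\<bar>"
      using k dual_cmult[OF f w] by (simp add: abs_mult flip: ennreal_mult)
    also have "\<dots> \<le> 1 + I (\<lambda>t. k * w t)"
      using main[of "\<lambda>t. k * w t"] by (cases "I (\<lambda>t. k * w t) < \<infinity>") (auto simp: less_top[symmetric])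
    finally show "ennreal \<bar>f w\<bar> \<le> amemiya M \<Phi> w k"
      unfolding amemiya_def by (rule ennreal_le_divideI[OF _ k])
  qed
  then show ?thesis
    unfolding orlicz_norm_eq_amemiya[OF w, symmetric] using norm_nonneg[OF w] by simp
qed

text \<open>Test \<open>f\<close> on a function that equals \<open>x\<close> off a small set \<open>E\<close> and \<open>y\<close> on \<open>E\<close>: the
  singular part only sees \<open>y\<close>, the integral and the modular only see \<open>x\<close>.\<close>

lemma integral_plus_singular_le:
  assumes fs: "purely_singular M \<Phi> fs"
    and v: "v \<in> orlicz_space M \<Psi>"
    and le: "\<And>w. w \<in> L \<Longrightarrow> (\<integral>t. w t * v t \<partial>M) + fs w \<le> N w"
    and x: "x \<in> borel_measurable M" "I x < \<infinity>"
    and y: "y \<in> borel_measurable M" "I y < \<infinity>"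
  shows "(\<integral>t. x t * v t \<partial>M) + fs y \<le> 1 + enn2real (I x)"
proof (rule field_le_epsilon)
  fix e0 :: real assume "e0 > 0"
  \<comment> \<open>The errors are \<open>2 * e\<close> in the singular part, \<open>e\<close> in
    the integral and \<open>e\<close> in the modular.\<close>
  define e where "e = e0 / 4"
  have e: "e > 0" using \<open>e0 > 0\<close> by (simp add: e_def)
  have f: "fs \<in> dual" using fs by (simp add: purely_singular_def)
  have v_meas [measurable]: "v \<in> borel_measurable M" using v by (simp add: orlicz_space_def)
  note [measurable] = x(1) y(1)
  have L: "x \<in> L" "y \<in> L" using L_if_modular_finite x y by auto
  \<comment> \<open>One integrable function controls on \<open>E\<close> everything that the
    replacement of \<open>x\<close> by \<open>y\<close> can change: the modular and both pairings
    with \<open>v\<close>.\<close>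
  define G where "G t = \<Phi> t (ennreal \<bar>y t\<bar>) + (ennreal (\<bar>x t\<bar> * \<bar>v t\<bar>) + ennreal (\<bar>y t\<bar> * \<bar>v t\<bar>))" for t
  have G: "G \<in> borel_measurable M" unfolding G_def by measurable
  have "(\<integral>\<^sup>+ t. G t \<partial>M) = I y + ((\<integral>\<^sup>+ t. ennreal (\<bar>x t\<bar> * \<bar>v t\<bar>) \<partial>M) + (\<integral>\<^sup>+ t. ennreal (\<bar>y t\<bar> * \<bar>v t\<bar>) \<partial>M))"
    unfolding G_def modular_def by (simp add: nn_integral_add)
  also have "\<dots> < \<infinity>"
    using y(2) nn_integral_product_finite[OF L(1) v] nn_integral_product_finite[OF L(2) v] by simp
  finally have Gf: "(\<integral>\<^sup>+ t. G t \<partial>M) < \<infinity>" .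
  have nn: "0 \<le> \<bar>x t\<bar> + \<bar>y t\<bar>" for t by simp
  obtain E where E: "E \<in> sets M" "(\<integral>\<^sup>+ t. G t * indicator E t \<partial>M) \<le> ennreal e"
    "\<And>z. z \<in> L \<Longrightarrow> (\<And>t. t \<in> space M \<Longrightarrow> \<bar>z t\<bar> \<le> \<bar>x t\<bar> + \<bar>y t\<bar>) \<Longrightarrow> (\<And>t. t \<in> E \<Longrightarrow> z t = 0) \<Longrightarrow> \<bar>fs z\<bar> \<le> e"
    using purely_singular_small_set[OF fs L_add[OF L_abs[OF L(1)] L_abs[OF L(2)]] nn e G Gf] by blast
  note [measurable] = E(1)
  define x1 where "x1 t = x t * indicator E t" for t
  define y1 where "y1 t = y t * indicator E t" for t
  have L1: "x1 \<in> L" "y1 \<in> L" unfolding x1_def y1_def using L_indicator[OF _ E(1)] L by auto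
  define z where "z t = (x t - x1 t) + y1 t" for t
  have zL: "z \<in> L" unfolding z_def by (rule L_add[OF L_diff[OF L(1) L1(1)] L1(2)])
  have "\<bar>fs (\<lambda>t. x t - x1 t)\<bar> \<le> e"
    by (rule E(3)[OF L_diff[OF L(1) L1(1)]]) (auto simp: x1_def indicator_def)
  moreover have "\<bar>fs (\<lambda>t. y t - y1 t)\<bar> \<le> e"
    by (rule E(3)[OF L_diff[OF L(2) L1(2)]]) (auto simp: y1_def indicator_def)
  moreover have "fs z = fs (\<lambda>t. x t - x1 t) + fs y1"
    unfolding z_def by (rule dual_add[OF f L_diff[OF L(1) L1(1)] L1(2)])
  ultimately have 1: "fs y - 2 * e \<le> fs z" using dual_diff[OF f L(2) L1(2)] by linarith
  have 2: "(\<integral>t. x t * v t \<partial>M) - e \<le> (\<integral>t. z t * v t \<partial>M)"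
  proof -
    have int: "integrable M (\<lambda>t. x t * v t)" "integrable M (\<lambda>t. z t * v t)"
      using integrable_product[OF _ v] L zL by auto
    have "ennreal \<bar>\<integral>t. x t * v t - z t * v t \<partial>M\<bar> \<le> (\<integral>\<^sup>+ t. ennreal \<bar>x t * v t - z t * v t\<bar> \<partial>M)"
      by (rule abs_integral_le_nn_integral)
    also have "\<dots> \<le> (\<integral>\<^sup>+ t. G t * indicator E t \<partial>M)"
    proof (rule nn_integral_mono)
      fix t
      show "ennreal \<bar>x t * v t - z t * v t\<bar> \<le> G t * indicator E t"
      proof (cases "t \<in> E")
        case True
        have "\<bar>x t * v t - z t * v t\<bar> = \<bar>x t * v t - y t * v t\<bar>"
          using True by (simp add: z_def x1_def y1_def)
        also have "\<dots> \<le> \<bar>x t\<bar> * \<bar>v t\<bar> + \<bar>y t\<bar> * \<bar>v t\<bar>"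
          using abs_triangle_ineq4[of "x t * v t" "y t * v t"] by (simp add: abs_mult)
        finally have "ennreal \<bar>x t * v t - z t * v t\<bar> \<le> ennreal (\<bar>x t\<bar> * \<bar>v t\<bar> + \<bar>y t\<bar> * \<bar>v t\<bar>)"
          by (rule ennreal_leI)
        also have "\<dots> \<le> G t" by (simp add: G_def ennreal_plus)
        finally show ?thesis using True by simp
      qed (simp add: z_def x1_def y1_def)
    qed
    also note E(2)
    finally have "\<bar>\<integral>t. x t * v t - z t * v t \<partial>M\<bar> \<le> e" using e by simp
    then show ?thesis using int by simp
  qed
  have Iz: "I z \<le> I x + ennreal e"
  proof -
    have "I z \<le> (\<integral>\<^sup>+ t. \<Phi> t (ennreal \<bar>x t\<bar>) + G t * indicator E t \<partial>M)"
      unfolding modular_def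
    proof (rule nn_integral_mono)
      fix t show "\<Phi> t (ennreal \<bar>z t\<bar>) \<le> \<Phi> t (ennreal \<bar>x t\<bar>) + G t * indicator E t"
        by (cases "t \<in> E") (auto simp: z_def x1_def y1_def G_def intro: add_increasing add_increasing2)
    qed
    also have "\<dots> = I x + (\<integral>\<^sup>+ t. G t * indicator E t \<partial>M)"
      unfolding modular_def using G by (simp add: nn_integral_add)
    finally show ?thesis using E(2) by (meson add_left_mono order_trans)
  qed
  obtain a where a: "I x = ennreal a" "a \<ge> 0" using x(2) by (cases "I x") auto
  have "ennreal (N z) \<le> 1 + (I x + ennreal e)"
    using norm_le_modular[OF zL] Iz by (meson add_left_mono order_trans)
  also have "\<dots> = ennreal (1 + (a + e))" using a e by simp
  finally have "N z \<le> 1 + (a + e)" using a e by (subst (asm) ennreal_le_iff) auto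
  then show "(\<integral>t. x t * v t \<partial>M) + fs y \<le> 1 + enn2real (I x) + e0"
    using le[OF zL] 1 2 a by (simp add: e_def)
qed

text \<open>\<open>x\<close> and \<open>y\<close> in the preceding estimate are independent.
  Optimizing over \<open>y\<close> yields the norm \<open>D\<close> of the singular part, and
  optimizing \<open>\<integral> x v - I x\<close> over \<open>x\<close> yields \<open>J v\<close>,
  by measurable selection.\<close>

lemma modular_le_if_dual_le_norm:
  assumes fs: "purely_singular M \<Phi> fs"
    and v: "v \<in> orlicz_space M \<Psi>"
    and le: "\<And>w. w \<in> L \<Longrightarrow> (\<integral>t. w t * v t \<partial>M) + fs w \<le> N w"
    and nonzero: "u \<in> L" "\<not> (AE t in M. u t = 0)"
  shows "J v + ennreal (dual_norm M \<Phi> fs) \<le> 1"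
proof -
  have f: "fs \<in> dual" using fs by (simp add: purely_singular_def)
  have v_meas [measurable]: "v \<in> borel_measurable M" using v by (simp add: orlicz_space_def)
  define D where "D = dual_norm M \<Phi> fs"
  have D: "D \<ge> 0" unfolding D_def by (rule dual_norm_nonneg[OF f nonzero])
  have *: "D \<le> 1 + enn2real (I x) - (\<integral>t. x t * v t \<partial>M)"
    if x: "x \<in> borel_measurable M" "I x < \<infinity>" for x
  proof -
    define d where "d = 1 + enn2real (I x) - (\<integral>t. x t * v t \<partial>M)"
    have fs_le: "\<bar>fs y\<bar> \<le> d" if y: "y \<in> borel_measurable M" "I y < \<infinity>" for y
    proof -
      note [measurable] = y(1)
      have "fs y \<le> d" using integral_plus_singular_le[OF fs v le x y] by (simp add: d_def)
      moreover have "fs (\<lambda>t. - y t) \<le> d"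
        using integral_plus_singular_le[OF fs v le x, of "\<lambda>t. - y t"] y by (simp add: d_def modular_def)
      ultimately show ?thesis
        using dual_uminus_arg[OF f L_if_modular_finite[OF y]] by simp
    qed
    have d0: "0 \<le> d" using fs_le[of "\<lambda>t. 0"] by (auto simp: modular_def)
    have "D \<le> d"
      unfolding D_def
    proof (rule dual_norm_le[OF nonzero])
      fix w assume w: "w \<in> L"
      note [measurable] = L_measurable[OF w]
      \<comment> \<open>For a nearly optimal Amemiya parameter \<open>k\<close> the modular of
        \<open>k * w\<close> is finite and \<open>1 <= k * (N w + e)\<close>; this turns the bound
        \<open>d\<close> at \<open>k * w\<close> into a bound at \<open>w\<close>.\<close>
      have "\<bar>fs w\<bar> \<le> d * (N w + e)" if e: "e > 0" for e
      proof -
        obtain k where k: "k > 0" "amemiya M \<Phi> w k \<le> ennreal (N w + e)"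
          using ex_amemiya_le[OF w e] by blast
        have "1 + I (\<lambda>t. k * w t) = ennreal k * amemiya M \<Phi> w k"
          unfolding amemiya_def using k(1) by (simp add: ennreal_divide_times mult.commute[of "ennreal k"])
        also have "\<dots> \<le> ennreal k * ennreal (N w + e)" by (rule mult_left_mono[OF k(2)]) simp
        also have "\<dots> = ennreal (k * (N w + e))" using k(1) e norm_nonneg[OF w] by (simp add: ennreal_mult)
        finally have le: "1 + I (\<lambda>t. k * w t) \<le> ennreal (k * (N w + e))" .
        then have "ennreal 1 \<le> ennreal (k * (N w + e))" using order_trans[OF _ le, of 1] by simp
        then have 1: "1 \<le> k * (N w + e)" using k e norm_nonneg[OF w] by (subst (asm) ennreal_le_iff) auto
        have "I (\<lambda>t. k * w t) < \<infinity>"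
          using le_less_trans[OF le ennreal_less_top] by simp
        then have "\<bar>fs (\<lambda>t. k * w t)\<bar> \<le> d" by (intro fs_le) auto
        then have "k * \<bar>fs w\<bar> \<le> d * 1" using dual_cmult[OF f w] k by (simp add: abs_mult)
        also have "\<dots> \<le> d * (k * (N w + e))" using 1 d0 by (rule mult_left_mono)
        finally have "k * \<bar>fs w\<bar> \<le> k * (d * (N w + e))" by (simp only: mult_ac)
        then show ?thesis using k(1) by simp
      qed
      note bound = this
      show "\<bar>fs w\<bar> \<le> d * N w"
      proof (rule field_le_epsilon)
        fix e :: real assume e: "e > 0"
        have "\<bar>fs w\<bar> \<le> d * (N w + e / (d + 1))" by (rule bound) (use e d0 in auto)
        also have "\<dots> = d * N w + (d / (d + 1)) * e" by (simp add: algebra_simps)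
        also have "\<dots> \<le> d * N w + 1 * e" using e d0 by (intro add_left_mono mult_right_mono) auto
        finally show "\<bar>fs w\<bar> \<le> d * N w + e" by simp
      qed
    qed
    then show ?thesis by (simp add: d_def)
  qed
  \<comment> \<open>Keeps \<open>ennreal (1 - D)\<close> from being truncated.\<close>
  have D1: "D \<le> 1" using *[of "\<lambda>t. 0"] by (simp add: modular_def)
  have "J v \<le> ennreal (1 - D)"
  proof (rule ccontr)
    assume "\<not> ?thesis"
    then have "ennreal (1 - D) < J v" by simp
    also have "J v = (\<integral>\<^sup>+ t. (SUP q\<in>\<rat> \<inter> {0..}. ennreal (\<bar>v t\<bar> * q) - \<Phi> t (ennreal q)) \<partial>M)"
      unfolding modular_def \<Psi>_conv_SUP by (simp add: mult.commute)
    finally obtain x where x: "x \<in> borel_measurable M" "\<And>t. 0 \<le> x t"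
      "(\<integral>\<^sup>+ t. \<Phi> t (ennreal (x t)) \<partial>M) < \<infinity>"
      "ennreal (1 - D) + (\<integral>\<^sup>+ t. \<Phi> t (ennreal (x t)) \<partial>M) < (\<integral>\<^sup>+ t. ennreal (\<bar>v t\<bar> * x t) \<partial>M)"
      by (rule ex_measurable_selection[rotated 3]) auto
    note [measurable] = x(1)
    \<comment> \<open>Unlike \<open>sgn (v t)\<close>, this sign keeps \<open>|x'| = x\<close> where
      \<open>v\<close> vanishes as well.\<close>
    define x' where "x' t = x t * (if 0 \<le> v t then 1 else - 1)" for t
    have x'_meas [measurable]: "x' \<in> borel_measurable M" unfolding x'_def by measurable
    have abs_x': "\<bar>x' t\<bar> = x t" and x'_v: "x' t * v t = \<bar>v t\<bar> * x t" for t
      using x(2)[of t] by (auto simp: x'_def)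
    have Ix': "I x' = (\<integral>\<^sup>+ t. \<Phi> t (ennreal (x t)) \<partial>M)" unfolding modular_def by (simp add: abs_x')
    then have fin: "I x' < \<infinity>" using x(3) by simp
    obtain a where a: "I x' = ennreal a" "a \<ge> 0" using fin by (cases "I x'") auto
    have int: "integrable M (\<lambda>t. x' t * v t)"
      by (rule integrable_product[OF L_if_modular_finite[OF x'_meas fin] v])
    have "(\<integral>\<^sup>+ t. ennreal (\<bar>v t\<bar> * x t) \<partial>M) = ennreal (\<integral>t. x' t * v t \<partial>M)"
      using nn_integral_eq_integral[OF int] x(2) by (simp add: x'_v)
    then have "ennreal ((1 - D) + a) < ennreal (\<integral>t. x' t * v t \<partial>M)"
      using x(4) a D1 unfolding Ix'[symmetric] by simp
    then have "(1 - D) + a < (\<integral>t. x' t * v t \<partial>M)"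
      using a D1 by (subst (asm) ennreal_less_iff) auto
    then show False using *[OF x'_meas fin] a by simp
  qed
  then have "J v + ennreal D \<le> ennreal (1 - D) + ennreal D" by (rule add_right_mono)
  also have "\<dots> = 1" using D D1 by (simp flip: ennreal_plus)
  finally show ?thesis by (simp add: D_def)
qed

end

section \<open>Functions without Amemiya minimizers\<close>

context musielak_orlicz_space
begin

abbreviation "b \<equiv> finiteness_bound \<Psi>"

lemma \<Phi>_le_Liminf:
  assumes "a \<longlonglongrightarrow> l"
  shows "\<Phi> t (ennreal l) \<le> liminf (\<lambda>n. \<Phi> t (ennreal (a n)))"
  unfolding le_Liminf_iff
proof (intro allI impI)
  fix y assume "y < \<Phi> t (ennreal l)"
  from \<Phi>_less_left[OF this] obtain s where s: "s < l" "y < \<Phi> t (ennreal s)" by metis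
  have "eventually (\<lambda>n. s < a n) sequentially" by (rule order_tendstoD(1)[OF assms s(1)])
  then show "eventually (\<lambda>n. y < \<Phi> t (ennreal (a n))) sequentially"
  proof eventually_elim
    case (elim n)
    then have "\<Phi> t (ennreal s) \<le> \<Phi> t (ennreal (a n))" by (intro \<Phi>_mono ennreal_leI) simp
    with s(2) show ?case by (rule less_le_trans)
  qed
qed

lemma modular_le_Liminf:
  assumes u: "u \<in> borel_measurable M" and "a \<longlonglongrightarrow> l"
  shows "I (\<lambda>t. l * u t) \<le> liminf (\<lambda>n. I (\<lambda>t. a n * u t))"
proof -
  note [measurable] = u
  have "I (\<lambda>t. l * u t) \<le> (\<integral>\<^sup>+ t. liminf (\<lambda>n. \<Phi> t (ennreal \<bar>a n * u t\<bar>)) \<partial>M)"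
    unfolding modular_def by (intro nn_integral_mono \<Phi>_le_Liminf tendsto_intros assms)
  also have "\<dots> \<le> liminf (\<lambda>n. I (\<lambda>t. a n * u t))"
    unfolding modular_def by (rule nn_integral_liminf) simp
  finally show ?thesis .
qed

lemma one_plus_modular_le_iff:
  assumes k: "k > 0" and c: "c \<ge> 0"
  shows "amemiya M \<Phi> w k \<le> ennreal c \<longleftrightarrow> 1 + I (\<lambda>t. k * w t) \<le> ennreal (k * c)"
proof -
  have eq: "1 + I (\<lambda>t. k * w t) = ennreal k * amemiya M \<Phi> w k"
    unfolding amemiya_def using k by (simp add: ennreal_divide_times mult.commute[of "ennreal k"])
  show ?thesis
    unfolding eq using k c by (simp add: ennreal_mult ennreal_mult_le_mult_iff)
qed

text \<open>Otherwise a minimizing sequence of parameters stays bounded and has a limit point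
  \<open>l\<close>. By Fatou the modular is lower semicontinuous along dilations of
  \<open>u\<close>, so \<open>l\<close> would be a minimizer.\<close>

lemma ex_large_amemiya_le:
  assumes u: "u \<in> L" and K: "amemiya_minimizers M \<Phi> u = {}" and e: "e > 0"
  shows "\<exists>k>c. k > 0 \<and> amemiya M \<Phi> u k \<le> ennreal (N u + e)"
proof (rule ccontr)
  assume no: "\<not> ?thesis"
  have N: "N u \<ge> 0" by (rule norm_nonneg[OF u])
  have "\<forall>j. \<exists>k>0. amemiya M \<Phi> u k \<le> ennreal (N u + e / real (Suc j))"
    using ex_amemiya_le[OF u] e by simp
  then obtain k where k: "\<And>j. k j > 0" "\<And>j. amemiya M \<Phi> u (k j) \<le> ennreal (N u + e / real (Suc j))"
    by metis
  have le: "1 + I (\<lambda>t. k j * u t) \<le> ennreal (k j * (N u + e / real (Suc j)))" for j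
    using k(2)[of j] by (subst (asm) one_plus_modular_le_iff) (use k N e in auto)
  have kc: "k j \<le> c" for j
  proof (rule ccontr)
    assume "\<not> k j \<le> c"
    moreover have "e / real (Suc j) \<le> e" using e by (simp add: divide_le_eq)
    then have "amemiya M \<Phi> u (k j) \<le> ennreal (N u + e)"
      by (intro order_trans[OF k(2)] ennreal_leI) simp
    ultimately show False using no k(1)[of j] by auto
  qed
  \<comment> \<open>The summand 1 in the Amemiya expression keeps the parameters away from 0; in the
    limit it yields \<open>1 <= l * N u\<close>, hence \<open>l > 0\<close>.\<close>
  have kl: "1 \<le> k j * (N u + e / real (Suc j))" for j
  proof -
    have "ennreal 1 \<le> ennreal (k j * (N u + e / real (Suc j)))"
      using order_trans[OF _ le[of j], of 1] by simp
    then show ?thesis using k(1)[of j] N e by (subst (asm) ennreal_le_iff) auto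
  qed
  have "\<forall>j. k j \<in> {0..c}" using k(1) kc by (auto intro: less_imp_le)
  then obtain l r where lr: "l \<in> {0..c}" "strict_mono r" "(k \<circ> r) \<longlonglongrightarrow> l"
    using compact_Icc[of 0 c] unfolding compact_eq_seq_compact_metric seq_compact_def by blast
  have "(\<lambda>j. e / real (Suc j)) \<longlonglongrightarrow> 0"
    by (intro tendsto_divide_0[OF tendsto_const] filterlim_compose[OF filterlim_real_sequentially filterlim_Suc]
        filterlim_at_top_imp_at_infinity)
  then have "((\<lambda>j. e / real (Suc j)) \<circ> r) \<longlonglongrightarrow> 0"
    by (rule LIMSEQ_subseq_LIMSEQ[OF _ lr(2)])
  then have lim: "(\<lambda>j. k (r j) * (N u + e / real (Suc (r j)))) \<longlonglongrightarrow> l * (N u + 0)"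
    using lr(3) unfolding comp_def by (intro tendsto_intros)
  have l1: "1 \<le> l * N u"
    using LIMSEQ_le_const[OF lim, of 1] kl by auto
  then have l: "l > 0" using lr(1) by (cases "l = 0") auto
  have "I (\<lambda>t. l * u t) \<le> liminf (\<lambda>j. I (\<lambda>t. (k \<circ> r) j * u t))"
    by (rule modular_le_Liminf[OF L_measurable[OF u] lr(3)])
  also have "\<dots> \<le> liminf (\<lambda>j. ennreal (k (r j) * (N u + e / real (Suc (r j))) - 1))"
  proof (rule Liminf_mono, rule always_eventually, rule allI)
    fix j
    have "1 + I (\<lambda>t. k (r j) * u t) - 1 \<le> ennreal (k (r j) * (N u + e / real (Suc (r j)))) - 1"
      by (intro ennreal_minus_mono le) auto
    also have "\<dots> = ennreal (k (r j) * (N u + e / real (Suc (r j))) - 1)"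
      by (simp add: ennreal_minus flip: ennreal_1)
    finally show "I (\<lambda>t. (k \<circ> r) j * u t) \<le> ennreal (k (r j) * (N u + e / real (Suc (r j))) - 1)"
      by simp
  qed
  also have "\<dots> = ennreal (l * (N u + 0) - 1)"
    by (intro lim_imp_Liminf tendsto_ennrealI tendsto_intros lim) simp
  finally have "I (\<lambda>t. l * u t) \<le> ennreal (l * N u - 1)" by simp
  then have "1 + I (\<lambda>t. l * u t) \<le> ennreal 1 + ennreal (l * N u - 1)" by (simp add: add_left_mono)
  also have "\<dots> = ennreal (l * N u)" using l1 by (simp flip: ennreal_plus del: ennreal_1)
  finally have "amemiya M \<Phi> u l \<le> ennreal (N u)" using one_plus_modular_le_iff[OF l N] by simp
  then have "amemiya M \<Phi> u l = ennreal (N u)"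
    by (intro antisym norm_le_amemiya u l)
  then have "l \<in> amemiya_minimizers M \<Phi> u"
    using l by (simp add: amemiya_minimizers_def orlicz_norm_eq_amemiya[OF u])
  with K show False by simp
qed

lemma modular_finite_if_no_minimizer:
  assumes u: "u \<in> L" and K: "amemiya_minimizers M \<Phi> u = {}" and k: "k > 0"
  shows "I (\<lambda>t. k * u t) < \<infinity>"
proof -
  obtain k' where k': "k' > k" "k' > 0" "amemiya M \<Phi> u k' \<le> ennreal (N u + 1)"
    using ex_large_amemiya_le[OF u K, of 1 k] by auto
  have "1 + I (\<lambda>t. k' * u t) \<le> ennreal (k' * (N u + 1))"
    using k' norm_nonneg[OF u] by (subst one_plus_modular_le_iff[symmetric]) auto
  then have "I (\<lambda>t. k' * u t) < \<infinity>" using le_less_trans[OF _ ennreal_less_top] by fastforce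
  moreover have "I (\<lambda>t. k * u t) \<le> I (\<lambda>t. k' * u t)"
    by (rule modular_mono) (use k k' in \<open>auto simp: abs_mult mult_right_mono\<close>)
  ultimately show ?thesis by (rule le_less_trans[rotated])
qed

section \<open>The finiteness bound as asymptotic slope and the norm of \<open>u\<close>\<close>

lemma AE_le_finiteness_bound:
  assumes v: "v \<in> borel_measurable M" and J: "J v < \<infinity>"
  shows "AE t in M. ennreal \<bar>v t\<bar> \<le> b t"
proof -
  note [measurable] = v
  have "AE t in M. \<Psi> t (ennreal \<bar>v t\<bar>) \<noteq> \<infinity>"
    using J unfolding modular_def by (intro nn_integral_noteq_infinite) (auto simp: less_top)
  then show ?thesis
    by eventually_elim (auto simp: finiteness_bound_def less_top intro!: Sup_upper)
qed

text \<open>The asymptotic slope of \<open>\<Phi> t\<close> is at least \<open>b t\<close>: for each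
  \<open>v\<close> with finite conjugate \<open>p\<close>, Young's inequality gives
  \<open>\<Phi> (k a) / k >= a v - p / k\<close>, and the last term vanishes as \<open>k\<close>
  grows.\<close>

lemma mult_finiteness_bound_le_Liminf:
  assumes k: "filterlim k at_top sequentially" "\<And>n. k n > 0"
  shows "ennreal a * b t \<le> liminf (\<lambda>n. \<Phi> t (ennreal (k n * a)) / ennreal (k n))"
proof (cases "a \<ge> 0")
  case True
  have "ennreal a * b t = (SUP v\<in>{v. \<Psi> t v < \<infinity>}. ennreal a * v)"
    unfolding finiteness_bound_def using SUP_mult_left_ennreal[of "ennreal a" "\<lambda>v. v"] by simp
  also have "\<dots> \<le> liminf (\<lambda>n. \<Phi> t (ennreal (k n * a)) / ennreal (k n))"
  proof (rule SUP_least)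
    fix v assume "v \<in> {v. \<Psi> t v < \<infinity>}"
    then obtain p where p: "\<Psi> t v = ennreal p" "p \<ge> 0" by (cases "\<Psi> t v") auto
    show "ennreal a * v \<le> liminf (\<lambda>n. \<Phi> t (ennreal (k n * a)) / ennreal (k n))"
      unfolding le_Liminf_iff
    proof (intro allI impI)
      fix y assume y: "y < ennreal a * v"
      obtain y' where y': "y = ennreal y'" "y' \<ge> 0" using y by (cases y) (auto simp: top_unique)
      have le: "ennreal (k n) * (ennreal a * v) \<le> \<Phi> t (ennreal (k n * a)) + ennreal p" for n
        using complementary_young[of "k n * a" v \<Phi> t] p True k(2)[of n]
        by (simp add: ennreal_mult mult.assoc)
      have "(\<lambda>n. p / k n) \<longlonglongrightarrow> 0"
        by (intro tendsto_divide_0[OF tendsto_const] filterlim_at_top_imp_at_infinity k(1))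
      then have "(\<lambda>n. ennreal (y' + p / k n)) \<longlonglongrightarrow> ennreal (y' + 0)"
        by (intro tendsto_ennrealI tendsto_intros)
      then have "eventually (\<lambda>n. ennreal (y' + p / k n) < ennreal a * v) sequentially"
        using y y' by (intro order_tendstoD(2)[where y = "ennreal (y' + 0)"]) auto
      then show "eventually (\<lambda>n. y < \<Phi> t (ennreal (k n * a)) / ennreal (k n)) sequentially"
      proof eventually_elim
        case (elim n)
        show ?case
        proof (rule ccontr)
          assume "\<not> ?case"
          then have "\<Phi> t (ennreal (k n * a)) / ennreal (k n) \<le> y" by simp
          then have "\<Phi> t (ennreal (k n * a)) / ennreal (k n) * ennreal (k n) \<le> y * ennreal (k n)"
            by (rule mult_right_mono) simp
          then have "\<Phi> t (ennreal (k n * a)) \<le> ennreal (y' * k n)"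
            using k(2)[of n] y' by (simp add: ennreal_divide_times ennreal_mult)
          then have "ennreal (k n) * (ennreal a * v) \<le> ennreal (y' * k n) + ennreal p"
            by (intro order_trans[OF le] add_right_mono)
          also have "\<dots> = ennreal (k n) * ennreal (y' + p / k n)"
            using k(2)[of n] y' p(2) by (simp add: algebra_simps flip: ennreal_mult ennreal_plus)
          also have "\<dots> < ennreal (k n) * (ennreal a * v)"
            using elim k(2)[of n] by (intro ennreal_mult_strict_left_mono) auto
          finally show False by simp
        qed
      qed
    qed
  qed
  finally show ?thesis .
qed (simp add: ennreal_neg)

text \<open>The upper estimate holds because each admissible \<open>v\<close> satisfies
  \<open>|v| <= b\<close> almost everywhere; the lower one is Fatou along nearly optimal parameters
  \<open>k n > n\<close>, dropping the summand \<open>1 / k n\<close>.\<close>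

lemma norm_eq_nn_integral_bound:
  assumes u: "u \<in> L" and K: "amemiya_minimizers M \<Phi> u = {}"
  shows "ennreal (N u) = (\<integral>\<^sup>+ t. ennreal \<bar>u t\<bar> * b t \<partial>M)"
proof (rule antisym)
  note [measurable] = L_measurable[OF u]
  show "ennreal (N u) \<le> (\<integral>\<^sup>+ t. ennreal \<bar>u t\<bar> * b t \<partial>M)"
  proof (rule norm_le_if[OF u])
    fix v assume v: "v \<in> borel_measurable M" "J v \<le> 1"
    have "ennreal \<bar>\<integral>t. u t * v t \<partial>M\<bar> \<le> (\<integral>\<^sup>+ t. ennreal \<bar>u t * v t\<bar> \<partial>M)"
      by (rule abs_integral_le_nn_integral)
    also have "\<dots> \<le> (\<integral>\<^sup>+ t. ennreal \<bar>u t\<bar> * b t \<partial>M)"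
    proof (rule nn_integral_mono_AE)
      have "J v < \<infinity>" using le_less_trans[OF v(2)] by simp
      from AE_le_finiteness_bound[OF v(1) this]
      show "AE t in M. ennreal \<bar>u t * v t\<bar> \<le> ennreal \<bar>u t\<bar> * b t"
        by eventually_elim (simp add: abs_mult ennreal_mult mult_left_mono)
    qed
    finally show "ennreal \<bar>\<integral>t. u t * v t \<partial>M\<bar> \<le> \<dots>" .
  qed
  have "\<forall>n. \<exists>k>real n. k > 0 \<and> amemiya M \<Phi> u k \<le> ennreal (N u + 1 / real (Suc n))"
    using ex_large_amemiya_le[OF u K] by simp
  then obtain k where k: "\<And>n. k n > real n" "\<And>n. k n > 0"
    "\<And>n. amemiya M \<Phi> u (k n) \<le> ennreal (N u + 1 / real (Suc n))"
    by metis
  have k_lim: "filterlim k at_top sequentially"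
    by (rule filterlim_at_top_mono[OF filterlim_real_sequentially]) (use k(1) in \<open>auto intro: always_eventually less_imp_le\<close>)
  have "(\<integral>\<^sup>+ t. ennreal \<bar>u t\<bar> * b t \<partial>M)
      \<le> (\<integral>\<^sup>+ t. liminf (\<lambda>n. \<Phi> t (ennreal (k n * \<bar>u t\<bar>)) / ennreal (k n)) \<partial>M)"
    by (intro nn_integral_mono mult_finiteness_bound_le_Liminf k_lim k(2))
  also have "\<dots> \<le> liminf (\<lambda>n. \<integral>\<^sup>+ t. \<Phi> t (ennreal (k n * \<bar>u t\<bar>)) / ennreal (k n) \<partial>M)"
    by (rule nn_integral_liminf) simp
  also have "\<dots> \<le> liminf (\<lambda>n. ennreal (N u + 1 / real (Suc n)))"
  proof (rule Liminf_mono, rule always_eventually, rule allI)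
    fix n
    have "(\<integral>\<^sup>+ t. \<Phi> t (ennreal (k n * \<bar>u t\<bar>)) / ennreal (k n) \<partial>M) = I (\<lambda>t. k n * u t) / ennreal (k n)"
      unfolding modular_def using k(2)[of n] by (simp add: nn_integral_divide abs_mult)
    also have "\<dots> \<le> amemiya M \<Phi> u (k n)"
      unfolding amemiya_def by (intro divide_right_mono_ennreal) simp
    also note k(3)[of n]
    finally show "(\<integral>\<^sup>+ t. \<Phi> t (ennreal (k n * \<bar>u t\<bar>)) / ennreal (k n) \<partial>M) \<le> ennreal (N u + 1 / real (Suc n))" .
  qed
  also have "\<dots> = ennreal (N u + 0)"
  proof (intro lim_imp_Liminf tendsto_ennrealI tendsto_intros)
    show "(\<lambda>n. 1 / real (Suc n)) \<longlonglongrightarrow> 0" by (rule lim_1_over_n[THEN LIMSEQ_Suc])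
  qed simp
  finally show "(\<integral>\<^sup>+ t. ennreal \<bar>u t\<bar> * b t \<partial>M) \<le> ennreal (N u)" by simp
qed

text \<open>Where \<open>u\<close> is nonzero and \<open>b\<close> infinite, both sides fail, since
  \<open>v\<close> is real. Where \<open>b\<close> is finite, \<open>|v| <= b\<close> matters when
  \<open>u v < 0\<close>: \<open>ennreal\<close> truncates that product to 0, but then
  \<open>|u| b > 0\<close>, so again both sides fail.\<close>

lemma sgn_mult_bound_iff:
  assumes t: "t \<in> space M" and le: "ennreal \<bar>v t\<bar> \<le> b t"
  shows "ereal (v t * indicator (supp M u) t)
           = ereal (sgn (u t)) * enn2ereal (b t) * indicator (supp M u) t
         \<longleftrightarrow> ennreal \<bar>u t\<bar> * b t = ennreal (u t * v t)"
proof (cases "u t = 0")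
  case True
  then show ?thesis by (simp add: supp_def)
next
  case u: False
  then have S: "t \<in> supp M u" using t by (simp add: supp_def)
  show ?thesis
  proof (cases "b t")
    case (real \<beta>)
    have v: "\<bar>v t\<bar> \<le> \<beta>" using le real by simp
    have "v t = sgn (u t) * \<beta> \<longleftrightarrow> ennreal (\<bar>u t\<bar> * \<beta>) = ennreal (u t * v t)"
    proof (cases "u t * v t \<ge> 0")
      case True
      have "\<bar>u t\<bar> * \<beta> = u t * (sgn (u t) * \<beta>)" by (simp add: sgn_if abs_if)
      then have "\<bar>u t\<bar> * \<beta> = u t * v t \<longleftrightarrow> v t = sgn (u t) * \<beta>" using u by auto
      then show ?thesis using True real(1) by (simp add: ennreal_inj)
    next
      case False
      then have "v t \<noteq> 0" by auto
      then have pos: "0 < \<bar>u t\<bar> * \<beta>" using u v by simp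
      have "u t * (sgn (u t) * \<beta>) = \<bar>u t\<bar> * \<beta>" by (simp add: sgn_if abs_if)
      then have "v t \<noteq> sgn (u t) * \<beta>" using False pos by (metis less_imp_le)
      moreover have "ennreal (u t * v t) = 0" using False by (simp add: ennreal_neg)
      then have "ennreal (\<bar>u t\<bar> * \<beta>) \<noteq> ennreal (u t * v t)"
        using pos by (metis ennreal_eq_0_iff not_le)
      ultimately show ?thesis by blast
    qed
    then show ?thesis using S real by (simp add: ennreal_mult)
  next
    case top
    then show ?thesis using S u by (auto simp: ennreal_mult_top sgn_if)
  qed
qed

theorem support_functional_iff:
  assumes u: "u \<in> L" "\<not> (AE t in M. u t = 0)" and K: "amemiya_minimizers M \<Phi> u = {}"
    and f: "f \<in> dual" and v: "v \<in> orlicz_space M \<Psi>" and fs: "purely_singular M \<Phi> fs"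
    and dec: "\<forall>w\<in>L. f w = integral_functional M v w + fs w"
  shows "support_functional M \<Phi> u f \<longleftrightarrow>
           J v + ennreal (dual_norm M \<Phi> fs) \<le> 1 \<and>
           (AE t in M. ereal (v t * indicator (supp M u) t) =
              ereal (sgn (u t)) * enn2ereal (b t) * indicator (supp M u) t)"
    (is "_ \<longleftrightarrow> ?i \<and> (AE t in M. ?ii t)")
proof -
  have v_meas [measurable]: "v \<in> borel_measurable M" using v by (simp add: orlicz_space_def)
  note [measurable] = L_measurable[OF u(1)]
  have dec': "f w = (\<integral>t. w t * v t \<partial>M) + fs w" if "w \<in> L" for w
    using dec that by (simp add: integral_functional_def)
  have fs0: "fs u = 0"
    by (rule purely_singular_eq_0[OF fs u modular_finite_if_no_minimizer[OF u(1) K]])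
  have fu: "f u = (\<integral>t. u t * v t \<partial>M)" using dec'[OF u(1)] fs0 by simp
  have int: "integrable M (\<lambda>t. u t * v t)" by (rule integrable_product[OF u(1) v])
  have Nu: "ennreal (N u) = (\<integral>\<^sup>+ t. ennreal \<bar>u t\<bar> * b t \<partial>M)"
    by (rule norm_eq_nn_integral_bound[OF u(1) K])
  have vb: "AE t in M. ennreal \<bar>v t\<bar> \<le> b t" if ?i
  proof (rule AE_le_finiteness_bound[OF v_meas])
    have "J v \<le> J v + ennreal (dual_norm M \<Phi> fs)" by simp
    also note that
    finally show "J v < \<infinity>" using le_less_trans[of "J v" 1 top] by simp
  qed
  \<comment> \<open>The pointwise equivalence needs \<open>|v| <= b\<close>, which the finite
    modular in the first condition supplies; hence the conditional form.\<close>
  have ii_iff: "(AE t in M. ?ii t) \<longleftrightarrow> (AE t in M. ennreal \<bar>u t\<bar> * b t = ennreal (u t * v t))" if ?i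
  proof -
    from vb[OF that] have "AE t in M. ?ii t \<longleftrightarrow> ennreal \<bar>u t\<bar> * b t = ennreal (u t * v t)"
      using AE_space by eventually_elim (rule sgn_mult_bound_iff)
    then show ?thesis by (rule eventually_subst)
  qed
  show ?thesis
  proof
    assume supp: "support_functional M \<Phi> u f"
    then have 1: "dual_norm M \<Phi> f = 1" and 2: "f u = N u" by (auto simp: support_functional_def)
    have "(\<integral>t. w t * v t \<partial>M) + fs w \<le> N w" if "w \<in> L" for w
      using dual_le_norm[OF f that] 1 dec'[OF that] by simp
    then have i: ?i by (rule modular_le_if_dual_le_norm[OF fs v _ u])
    have p_le: "AE t in M. ennreal (u t * v t) \<le> ennreal \<bar>u t\<bar> * b t"
      using vb[OF i]
    proof eventually_elim
      case (elim t)
      have "ennreal (u t * v t) \<le> ennreal (\<bar>u t\<bar> * \<bar>v t\<bar>)"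
        by (intro ennreal_leI) (simp flip: abs_mult)
      also have "\<dots> = ennreal \<bar>u t\<bar> * ennreal \<bar>v t\<bar>" by (simp add: ennreal_mult)
      also have "\<dots> \<le> ennreal \<bar>u t\<bar> * b t" by (rule mult_left_mono[OF elim]) simp
      finally show ?case .
    qed
    \<comment> \<open>This is the integral of the positive part of \<open>u v\<close>. It lies
      between \<open>\<integral> u v = N u\<close> and \<open>\<integral> |u| b = N u\<close>, so
      the pointwise gap to \<open>|u| b\<close> integrates to 0.\<close>
    have fin: "(\<integral>\<^sup>+ t. ennreal (u t * v t) \<partial>M) \<noteq> \<infinity>"
      using nn_integral_mono_AE[OF p_le] unfolding Nu[symmetric] by (auto simp: top_unique)
    have "ennreal (N u) \<le> (\<integral>\<^sup>+ t. ennreal (u t * v t) \<partial>M)"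
    proof -
      have "(\<integral>t. u t * v t \<partial>M) \<le> enn2real (\<integral>\<^sup>+ t. ennreal (u t * v t) \<partial>M)"
        using real_lebesgue_integral_def[OF int] by simp
      then have "ennreal (N u) \<le> ennreal (enn2real (\<integral>\<^sup>+ t. ennreal (u t * v t) \<partial>M))"
        using 2 fu by (intro ennreal_leI) simp
      moreover have "ennreal (enn2real (\<integral>\<^sup>+ t. ennreal (u t * v t) \<partial>M)) = (\<integral>\<^sup>+ t. ennreal (u t * v t) \<partial>M)"
        by (rule ennreal_enn2real) (use fin in \<open>simp add: less_top\<close>)
      ultimately show ?thesis by (simp only:)
    qed
    then have "(\<integral>\<^sup>+ t. ennreal \<bar>u t\<bar> * b t \<partial>M) - (\<integral>\<^sup>+ t. ennreal (u t * v t) \<partial>M) = 0"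
      unfolding Nu[symmetric] by (intro diff_eq_0_ennreal) auto
    then have "(\<integral>\<^sup>+ t. ennreal \<bar>u t\<bar> * b t - ennreal (u t * v t) \<partial>M) = 0"
      by (subst nn_integral_diff[OF _ _ fin p_le]) auto
    then have "AE t in M. ennreal \<bar>u t\<bar> * b t - ennreal (u t * v t) = 0"
      by (subst (asm) nn_integral_0_iff_AE) auto
    then have "AE t in M. ennreal \<bar>u t\<bar> * b t = ennreal (u t * v t)"
      using p_le by eventually_elim (auto dest: ennreal_minus_eq_0 intro: antisym)
    with i ii_iff[OF i] show "?i \<and> (AE t in M. ?ii t)" by blast
  next
    assume "?i \<and> (AE t in M. ?ii t)"
    then have i: ?i and eq: "AE t in M. ennreal \<bar>u t\<bar> * b t = ennreal (u t * v t)"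
      using ii_iff by blast+
    have f_le: "\<bar>f w\<bar> \<le> N w" if "w \<in> L" for w
      by (rule dual_le_norm_if_modular_le[OF fs f v dec' i u that])
    \<comment> \<open>Needed because \<open>ennreal\<close> hides negative products: if
      \<open>u t * v t < 0\<close>, the equality would force \<open>|u t| b t = 0\<close>, contrary
      to \<open>b t >= |v t| > 0\<close>.\<close>
    have "AE t in M. 0 \<le> u t * v t"
      using eq vb[OF i]
    proof eventually_elim
      case (elim t)
      show ?case
      proof (rule ccontr)
        assume neg: "\<not> ?case"
        then have "u t \<noteq> 0" "v t \<noteq> 0" by auto
        moreover have "ennreal \<bar>u t\<bar> * b t = 0" using elim(1) neg by (simp add: ennreal_neg)
        ultimately show False using elim(2) by (auto simp: ennreal_eq_0_iff)
      qed
    qed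
    then have "(\<integral>\<^sup>+ t. ennreal (u t * v t) \<partial>M) = ennreal (f u)" and "0 \<le> f u"
      using nn_integral_eq_integral[OF int] integral_nonneg_AE[of "\<lambda>t. u t * v t" M] by (auto simp: fu)
    moreover have "(\<integral>\<^sup>+ t. ennreal (u t * v t) \<partial>M) = ennreal (N u)"
      unfolding Nu by (rule nn_integral_cong_AE) (use eq in eventually_elim, simp)
    ultimately have fuN: "f u = N u" using norm_nonneg[OF u(1)] by simp
    have "dual_norm M \<Phi> f \<le> 1" by (rule dual_norm_le[OF u]) (use f_le in simp)
    moreover have "1 \<le> dual_norm M \<Phi> f"
      using dual_le_norm[OF f u(1)] fuN norm_pos[OF u] by simp
    ultimately show "support_functional M \<Phi> u f"
      using f fuN by (simp add: support_functional_def)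
  qed
qed

end

text \<open>Supplies the values with which \<Phi> is overwritten at exceptional points.\<close>

lemma young_function_id: "young_function (\<lambda>u. u)"
proof
  show "convex_ennreal (\<lambda>u. u)" by (simp add: convex_ennreal_def)
  show "lower_semicontinuous_ennreal (\<lambda>u. u)"
    unfolding lower_semicontinuous_ennreal_def le_Liminf_iff
    by (auto intro: order_tendstoD(1)[OF tendsto_ident_at])
qed simp_all

theorem proposition10:
  fixes M :: "'a measure"
    and \<Phi> :: "'a \<Rightarrow> ennreal \<Rightarrow> ennreal"
    and u v :: "'a \<Rightarrow> real"
    and f fs :: "('a \<Rightarrow> real) \<Rightarrow> real"
  assumes "sigma_finite_measure M"
    and "non_atomic M"
    and "musielak_orlicz M \<Phi>"
    and "u \<in> orlicz_space M \<Phi>"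
    and "\<not> (AE t in M. u t = 0)"
    and "amemiya_minimizers M \<Phi> u = {}"
    and "f \<in> orlicz_dual M \<Phi>"
    and "v \<in> orlicz_space M (complementary \<Phi>)"
    and "purely_singular M \<Phi> fs"
    and "\<forall>w\<in>orlicz_space M \<Phi>. f w = integral_functional M v w + fs w"
  shows "support_functional M \<Phi> u f \<longleftrightarrow>
           modular M (complementary \<Phi>) v + ennreal (dual_norm M \<Phi> fs) \<le> 1 \<and>
           (AE t in M. ereal (v t * indicator (supp M u) t) =
              ereal (sgn (u t)) * enn2ereal (finiteness_bound (complementary \<Phi>) t)
                * indicator (supp M u) t)"
proof -
  have "AE t in M. young_function (\<Phi> t)"
    using assms(3) unfolding musielak_orlicz_def
    by (elim conjE, elim eventually_mono) (auto intro: young_function.intro)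
  then obtain Z where Z: "{t \<in> space M. \<not> young_function (\<Phi> t)} \<subseteq> Z" "emeasure M Z = 0" "Z \<in> sets M"
    by (rule AE_E)
  \<comment> \<open>All notions involved ignore null sets, so \<open>\<Phi>\<close> may be replaced by a \<open>\<Phi>'\<close> that is a
    Young function at every point.\<close>
  define \<Phi>' where "\<Phi>' t = (if t \<in> space M - Z then \<Phi> t else (\<lambda>u. u))" for t
  have AE_eq: "AE t in M. \<Phi> t = \<Phi>' t"
    using AE_not_in[of Z M] Z(2,3) AE_space by (auto simp: \<Phi>'_def null_sets_def elim!: eventually_mono)
  interpret musielak_orlicz_space M \<Phi>'
  proof (intro musielak_orlicz_space.intro musielak_orlicz_space_axioms.intro assms(1))
    show "young_function (\<Phi>' t)" for t
      using Z(1) young_function_id by (auto simp: \<Phi>'_def)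
    fix u :: real assume "u \<ge> 0"
    then have [measurable]: "(\<lambda>t. \<Phi> t (ennreal u)) \<in> borel_measurable M"
      using assms(3) by (simp add: musielak_orlicz_def)
    note [measurable] = Z(3)
    have "(\<lambda>t. if t \<in> space M - Z then \<Phi> t (ennreal u) else ennreal u) \<in> borel_measurable M"
      by measurable
    then show "(\<lambda>t. \<Phi>' t (ennreal u)) \<in> borel_measurable M"
      by (rule measurable_cong[THEN iffD1, rotated]) (simp add: \<Phi>'_def)
  qed
  have AE_eq': "AE t in M. complementary \<Phi> t = complementary \<Phi>' t"
    using AE_eq by eventually_elim (simp add: complementary_def fun_eq_iff)
  have I: "modular M \<Phi> = modular M \<Phi>'"
    unfolding modular_def fun_eq_iff
    by (intro allI nn_integral_cong_AE) (use AE_eq in eventually_elim, simp)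
  have J: "modular M (complementary \<Phi>) = modular M (complementary \<Phi>')"
    unfolding modular_def fun_eq_iff
    by (intro allI nn_integral_cong_AE) (use AE_eq' in eventually_elim, simp)
  have L: "orlicz_space M \<Phi> = orlicz_space M \<Phi>'"
    "orlicz_space M (complementary \<Phi>) = orlicz_space M (complementary \<Phi>')"
    "orlicz_class M (complementary \<Phi>) = orlicz_class M (complementary \<Phi>')"
    by (simp_all add: orlicz_space_def orlicz_class_def I J)
  have N: "orlicz_norm M \<Phi> = orlicz_norm M \<Phi>'"
    by (simp add: orlicz_norm_def L J fun_eq_iff)
  have K: "amemiya_minimizers M \<Phi> u = amemiya_minimizers M \<Phi>' u"
    by (simp add: amemiya_minimizers_def amemiya_def I)
  have D: "orlicz_dual M \<Phi> = orlicz_dual M \<Phi>'" "dual_norm M \<Phi> = dual_norm M \<Phi>'"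
    by (simp_all add: orlicz_dual_def dual_norm_def L N fun_eq_iff)
  have "functional_pos_part M \<Phi> = functional_pos_part M \<Phi>'"
    by (simp add: functional_pos_part_def L fun_eq_iff)
  moreover have "oc_part_cone M \<Phi> = oc_part_cone M \<Phi>'"
    by (simp add: oc_part_cone_def L fun_eq_iff)
  ultimately have S: "purely_singular M \<Phi> = purely_singular M \<Phi>'"
    by (intro ext) (simp add: purely_singular_def order_continuous_part_def oc_part_pos_def L D)
  have T: "support_functional M \<Phi> u f = support_functional M \<Phi>' u f"
    by (simp add: support_functional_def D N)
  have "(AE t in M. ereal (v t * indicator (supp M u) t) =
           ereal (sgn (u t)) * enn2ereal (finiteness_bound (complementary \<Phi>) t) * indicator (supp M u) t) \<longleftrightarrow>
        (AE t in M. ereal (v t * indicator (supp M u) t) =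
           ereal (sgn (u t)) * enn2ereal (finiteness_bound (complementary \<Phi>') t) * indicator (supp M u) t)"
    by (rule eventually_subst) (use AE_eq' in eventually_elim, simp add: finiteness_bound_def)
  then show ?thesis
    using support_functional_iff[of u f v fs] assms(4-) unfolding I J L N K D S T by simp
qed

end
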